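(* Let $p\ge 1$, let $\mathcal{G}\subseteq 2^{\{1,\ldots,p\}}$ be a set of groups of variables (arbitrarily overlapping), let $(\eta_g)_{g\in\mathcal{G}}$ be positive weights, let $\lambda>0$ and let $\mathbf{u}\in\mathbb{R}^p$. Let $\Omega(\mathbf{w})=\sum_{g\in\mathcal{G}}\eta_g\|\mathbf{w}_g\|_\infty$, where $\mathbf{w}_g\in\mathbb{R}^{|g|}$ is the vector of the coefficients of $\mathbf{w}$ indexed by $g$. Then Algorithm 1 (defined in the context), run on the input $(\mathbf{u},\mathcal{G},(\eta_g)_{g\in\mathcal{G}},\lambda)$, solves the proximal problem: the vector $\mathbf{w}$ it returns is the unique solution of $$\min_{\mathbf{w}\in\mathbb{R}^p}\ \frac12\|\mathbf{u}-\mathbf{w}\|_2^2+\lambda\,\Omega(\mathbf{w}).$$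
   Context: Groups in $\mathcal{G}$ are nonempty subsets of $\{1,\ldots,p\}$. Sign convention: one may assume $\mathbf{u}_j\ge 0$ for all $j$; for a general $\mathbf{u}$ the algorithm is run on $(|\mathbf{u}_j|)_j$ and the signs of the $\mathbf{u}_j$ are restored in the output (each output entry is multiplied by the sign of $\mathbf{u}_j$). Flows: on a directed graph with source $s$, sink $t$ and non-negative arc capacities, a flow is a non-negative function on arcs, bounded by the capacity on each arc, such that incoming and outgoing flow are equal at every vertex other than $s,t$. Canonical graph: $G=(V,E,s,t)$ with $V=V_u\cup V_{gr}$, where $V_u=\{1,\ldots,p\}$ (one vertex per variable) and $V_{gr}=\mathcal{G}$ (one vertex per group), and whose arcs are: $(s,g)$ for every $g\in\mathcal{G}$, with capacity $\lambda\eta_g$ and zero cost; $(g,j)$ for every $g\in\mathcal{G}$ and $j\in g$, with infinite capacity and zero cost; $(j,t)$ for every $j\in\{1,\ldots,p\}$, with infinite capacity and cost $\frac12(\mathbf{u}_j-\overline{\boldsymbol\xi}_j)^2$, where $\overline{\boldsymbol\xi}_j$ denotes the flow on $(j,t)$. Algorithm 1: build the canonical graph $G_0=(V_0,E_0,s,t)$, compute $\overline{\boldsymbol\xi}\leftarrow\texttt{computeFlow}(V_0,E_0)$, and return $\mathbf{w}=\mathbf{u}-\overline{\boldsymbol\xi}$. The recursive function $\texttt{computeFlow}(V=V_u\cup V_{gr},E)$ is: (1) Projection step: let $\boldsymbol\gamma=(\boldsymbol\gamma_j)_{j\in V_u}$ be the minimizer of $\sum_{j\in V_u}\frac12(\mathbf{u}_j-\boldsymbol\gamma_j)^2$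 subject to $\boldsymbol\gamma_j\ge 0$ for all $j\in V_u$ and $\sum_{j\in V_u}\boldsymbol\gamma_j\le\lambda\sum_{g\in V_{gr}}\eta_g$. (2) For all $j\in V_u$, set the capacity of the arc $(j,t)$ to $\boldsymbol\gamma_j$. (3) Max-flow step: compute a maximum flow from $s$ to $t$ on $(V,E,s,t)$, and let $\overline{\boldsymbol\xi}_j$ be its value on $(j,t)$, $j\in V_u$. (4) If there exists $j\in V_u$ with $\overline{\boldsymbol\xi}_j\ne\boldsymbol\gamma_j$: let $(s,V^+)$ and $(V^-,t)$ be the two disjoint parts of $V \cup\{s,t\}$ separated by the minimum $(s,t)$-cut, where $V^+$ is the set of vertices of $V$ reachable from $s$ by a non-saturated path (a path in the residual graph of the max-flow) and $V^-=V\setminus V^+$; remove all arcs between $V^+$ and $V^-$, and let $E^+$, $E^-$ be the remaining arcs corresponding to $V^+$ and $V^-$ (including the arcs to/from $s,t$); replace $(\overline{\boldsymbol\xi}_j)_{j\in V_u\cap V^+}$ by $\texttt{computeFlow}(V^+,E^+)$ and $(\overline{\boldsymbol\xi}_j)_{j\in V_u\cap V^-}$ by $\texttt{computeFlow}(V^-,E^-)$. (5) Return $(\overline{\boldsymbol\xi}_j)_{j\in V_u}$. *)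

theory Defs
  imports "HOL-Analysis.Analysis"
begin

subsection \<open>Flows\<close>

text \<open>A network is given by its vertex set (containing the source \<open>s\<close> and the sink \<open>t\<close>), its arc set,
  and a capacity function with values in \<open>[0, \<infinity>]\<close>. Values of a flow outside the arc set are irrelevant.\<close>

definition is_flow ::
  "'v \<Rightarrow> 'v \<Rightarrow> 'v set \<Rightarrow> ('v \<times> 'v) set \<Rightarrow> ('v \<times> 'v \<Rightarrow> ereal) \<Rightarrow> ('v \<times> 'v \<Rightarrow> real) \<Rightarrow> bool" where
  "is_flow s t V E c f \<longleftrightarrow>
     (\<forall>e\<in>E. 0 \<le> f e \<and> ereal (f e) \<le> c e) \<and>
     (\<forall>v\<in>V - {s, t}. (\<Sum>e | e \<in> E \<and> snd e = v. f e) = (\<Sum>e | e \<in> E \<and> fst e = v. f e))"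

definition flow_value :: "'v \<Rightarrow> ('v \<times> 'v) set \<Rightarrow> ('v \<times> 'v \<Rightarrow> real) \<Rightarrow> real" where
  "flow_value s E f = (\<Sum>e | e \<in> E \<and> fst e = s. f e) - (\<Sum>e | e \<in> E \<and> snd e = s. f e)"

definition is_max_flow ::
  "'v \<Rightarrow> 'v \<Rightarrow> 'v set \<Rightarrow> ('v \<times> 'v) set \<Rightarrow> ('v \<times> 'v \<Rightarrow> ereal) \<Rightarrow> ('v \<times> 'v \<Rightarrow> real) \<Rightarrow> bool" where
  "is_max_flow s t V E c f \<longleftrightarrow>
     is_flow s t V E c f \<and> (\<forall>f'. is_flow s t V E c f' \<longrightarrow> flow_value s E f' \<le> flow_value s E f)"

definition residual_arcs ::
  "('v \<times> 'v) set \<Rightarrow> ('v \<times> 'v \<Rightarrow> ereal) \<Rightarrow> ('v \<times> 'v \<Rightarrow> real) \<Rightarrow> ('v \<times> 'v) set" where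
  "residual_arcs E c f =
     {(x, y). ((x, y) \<in> E \<and> ereal (f (x, y)) < c (x, y)) \<or> ((y, x) \<in> E \<and> 0 < f (y, x))}"

text \<open>Maximum flows are not unique, so the max-flow subroutine is a parameter of the algorithm:
  any function that returns some maximum flow whenever there is one.\<close>

type_synonym 'v flow_solver =
  "'v \<Rightarrow> 'v \<Rightarrow> 'v set \<Rightarrow> ('v \<times> 'v) set \<Rightarrow> ('v \<times> 'v \<Rightarrow> ereal) \<Rightarrow> ('v \<times> 'v \<Rightarrow> real)"

definition max_flow_solver :: "'v flow_solver \<Rightarrow> bool" where
  "max_flow_solver mf \<longleftrightarrow>
     (\<forall>s t V E c. (\<exists>f. is_max_flow s t V E c f) \<longrightarrow> is_max_flow s t V E c (mf s t V E c))"


subsection \<open>The canonical graph\<close>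

text \<open>The variables \<open>1, \<dots>, p\<close> are the elements of the finite type \<open>'n\<close>.\<close>

datatype 'n node = Source | Sink | Var 'n | Group "'n set"

definition vars :: "'n node set \<Rightarrow> 'n set" where
  "vars V = {j. Var j \<in> V}"

definition groups :: "'n node set \<Rightarrow> 'n set set" where
  "groups V = {g. Group g \<in> V}"

definition canonical_verts :: "'n set set \<Rightarrow> 'n node set" where
  "canonical_verts \<G> = range Var \<union> Group ` \<G>"

definition canonical_arcs :: "'n set set \<Rightarrow> ('n node \<times> 'n node) set" where
  "canonical_arcs \<G> =
     {(Source, Group g) | g. g \<in> \<G>} \<union>
     {(Group g, Var j) | g j. g \<in> \<G> \<and> j \<in> g} \<union>
     {(Var j, Sink) | j. True}"

text \<open>The last equation only concerns pairs that are not arcs.\<close>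

fun canonical_cap :: "real \<Rightarrow> ('n set \<Rightarrow> real) \<Rightarrow> 'n node \<times> 'n node \<Rightarrow> ereal" where
  "canonical_cap lam \<eta> (Source, Group g) = ereal (lam * \<eta> g)"
| "canonical_cap lam \<eta> (Group g, Var j) = \<infinity>"
| "canonical_cap lam \<eta> (Var j, Sink) = \<infinity>"
| "canonical_cap lam \<eta> _ = 0"

definition set_sink_caps ::
  "'n set \<Rightarrow> real ^ 'n \<Rightarrow> ('n node \<times> 'n node \<Rightarrow> ereal) \<Rightarrow> 'n node \<times> 'n node \<Rightarrow> ereal" where
  "set_sink_caps U \<gamma> c e =
     (case e of (Var j, Sink) \<Rightarrow> if j \<in> U then ereal (\<gamma> $ j) else c e | _ \<Rightarrow> c e)"


subsection \<open>The algorithm\<close>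

text \<open>A vector indexed by a subset \<open>U\<close> of the variables is represented by a vector that vanishes
  outside \<open>U\<close>. The objective is the total cost of the arcs \<open>(j, t)\<close>, \<open>j \<in> U\<close>, of the canonical
  graph.\<close>

definition projection :: "real ^ 'n \<Rightarrow> 'n set \<Rightarrow> real \<Rightarrow> real ^ 'n" where
  "projection u U b =
     (THE \<gamma>. is_arg_min
        (\<lambda>\<gamma>. \<Sum>j\<in>U. 1 / 2 * (u $ j - \<gamma> $ j)\<^sup>2)
        (\<lambda>\<gamma>. (\<forall>j\<in>U. 0 \<le> \<gamma> $ j) \<and> (\<Sum>j\<in>U. \<gamma> $ j) \<le> b \<and> (\<forall>j. j \<notin> U \<longrightarrow> \<gamma> $ j = 0))
        \<gamma>)"

definition restrict_arcs :: "'n node set \<Rightarrow> ('n node \<times> 'n node) set \<Rightarrow> ('n node \<times> 'n node) set" where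
  "restrict_arcs V E = E \<inter> ((V \<union> {Source, Sink}) \<times> (V \<union> {Source, Sink}))"

text \<open>Termination is not built in: the equation below holds under \<open>computeFlow_dom\<close>, the
  accessible part of the relation between recursive calls.\<close>

function (domintros) computeFlow ::
  "('n::finite) node flow_solver \<Rightarrow> real ^ 'n \<Rightarrow> ('n set \<Rightarrow> real) \<Rightarrow> real \<Rightarrow>
   'n node set \<Rightarrow> ('n node \<times> 'n node) set \<Rightarrow> real ^ 'n" where
  "computeFlow mf u \<eta> lam V E =
     (let \<gamma> = projection u (vars V) (lam * (\<Sum>g\<in>groups V. \<eta> g));
          c = set_sink_caps (vars V) \<gamma> (canonical_cap lam \<eta>);
          f = mf Source Sink (V \<union> {Source, Sink}) E c;
          \<xi> = (\<chi> j. if j \<in> vars V then f (Var j, Sink) else 0)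
      in if \<exists>j\<in>vars V. \<xi> $ j \<noteq> \<gamma> $ j
         then
           let Vp = V \<inter> (residual_arcs E c f)\<^sup>* `` {Source};
               Vm = V - Vp;
               \<xi>p = computeFlow mf u \<eta> lam Vp (restrict_arcs Vp E);
               \<xi>m = computeFlow mf u \<eta> lam Vm (restrict_arcs Vm E)
           in \<chi> j. if j \<in> vars Vp then \<xi>p $ j else if j \<in> vars Vm then \<xi>m $ j else 0
         else \<xi>)"
  by pat_completeness auto

definition algorithm1_nonneg ::
  "('n::finite) node flow_solver \<Rightarrow> real ^ 'n \<Rightarrow> 'n set set \<Rightarrow> ('n set \<Rightarrow> real) \<Rightarrow> real \<Rightarrow> real ^ 'n" where
  "algorithm1_nonneg mf u \<G> \<eta> lam =
     u - computeFlow mf u \<eta> lam (canonical_verts \<G>) (canonical_arcs \<G>)"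

definition abs_vec :: "real ^ 'n \<Rightarrow> real ^ 'n" where
  "abs_vec u = (\<chi> j. \<bar>u $ j\<bar>)"

definition algorithm1 ::
  "('n::finite) node flow_solver \<Rightarrow> real ^ 'n \<Rightarrow> 'n set set \<Rightarrow> ('n set \<Rightarrow> real) \<Rightarrow> real \<Rightarrow> real ^ 'n" where
  "algorithm1 mf u \<G> \<eta> lam = (\<chi> j. sgn (u $ j) * algorithm1_nonneg mf (abs_vec u) \<G> \<eta> lam $ j)"

definition algorithm1_terminates ::
  "('n::finite) node flow_solver \<Rightarrow> real ^ 'n \<Rightarrow> 'n set set \<Rightarrow> ('n set \<Rightarrow> real) \<Rightarrow> real \<Rightarrow> bool" where
  "algorithm1_terminates mf u \<G> \<eta> lam \<longleftrightarrow>
     computeFlow_dom (mf, abs_vec u, \<eta>, lam, canonical_verts \<G>, canonical_arcs \<G>)"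


subsection \<open>The proximal problem\<close>

definition group_norm :: "'n set set \<Rightarrow> ('n set \<Rightarrow> real) \<Rightarrow> real ^ 'n \<Rightarrow> real" where
  "group_norm \<G> \<eta> w = (\<Sum>g\<in>\<G>. \<eta> g * Max ((\<lambda>j. \<bar>w $ j\<bar>) ` g))"

definition prox_objective ::
  "real ^ 'n \<Rightarrow> 'n set set \<Rightarrow> ('n set \<Rightarrow> real) \<Rightarrow> real \<Rightarrow> real ^ 'n \<Rightarrow> real" where
  "prox_objective u \<G> \<eta> lam w = 1 / 2 * (norm (u - w))\<^sup>2 + lam * group_norm \<G> \<eta> w"

end

theory Submission
  imports Defs
begin

text \<open>A vector \<open>\<xi>\<close> of sink flows is optimal iff it splits into group flows \<open>F g\<close> of mass at most
  \<open>\<lambda> \<eta>\<^sub>g\<close> such that \<open>F g\<close> only charges the maximisers of \<open>w = u - \<xi>\<close> on \<open>g\<close>, and \<open>w\<close> vanishes on \<open>g\<close>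
  when the mass of \<open>F g\<close> is smaller than \<open>\<lambda> \<eta>\<^sub>g\<close>. These conditions survive the recursion. The projection
  is the soft threshold \<open>\<gamma>\<^sub>j = max (u\<^sub>j - \<tau>) 0\<close>; if the maximum flow attains it, \<open>\<xi> = \<gamma>\<close> satisfies them.
  Otherwise counting the flow of the groups across the threshold shows that \<open>w \<le> \<tau>\<close> on the
  source side of the minimum cut, while every group on the sink side has a variable on that side with
  \<open>w \<ge> \<tau>\<close>. Hence the discarded arcs, which lead from groups on the sink side to variables on the
  source side, do not change the maximisers, and the two partial solutions can be merged. Both sides
  of the cut are nonempty, which gives termination.\<close>

section \<open>Optimality conditions for routings\<close>

text \<open>A routing is total and vanishes off its support, so all sums can run over
  \<open>UNIV\<close> and be swapped freely, and two routings with disjoint supports can be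
  added.\<close>

definition routing :: "('n::finite) set set \<Rightarrow> 'n set \<Rightarrow> ('n set \<Rightarrow> 'n \<Rightarrow> real) \<Rightarrow> bool" where
  "routing H U F \<longleftrightarrow> (\<forall>g j. 0 \<le> F g j \<and> (F g j \<noteq> 0 \<longrightarrow> g \<in> H \<and> j \<in> g \<and> j \<in> U))"

text \<open>The last two conditions are the complementary slackness conditions of the proximal problem
  restricted to the variables \<open>U\<close> and the groups \<open>g \<inter> U\<close>, \<open>g \<in> H\<close>.\<close>

definition kkt ::
  "real ^ ('n::finite) \<Rightarrow> ('n set \<Rightarrow> real) \<Rightarrow> 'n set \<Rightarrow> 'n set set \<Rightarrow> real ^ 'n \<Rightarrow> ('n set \<Rightarrow> 'n \<Rightarrow> real) \<Rightarrow> bool" where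
  "kkt u r U H \<xi> F \<longleftrightarrow> routing H U F
     \<and> (\<forall>g\<in>H. (\<Sum>j\<in>UNIV. F g j) \<le> r g)
     \<and> (\<forall>j\<in>U. \<xi> $ j = (\<Sum>g\<in>UNIV. F g j))
     \<and> (\<forall>j\<in>U. \<xi> $ j \<le> u $ j)
     \<and> (\<forall>g j i. F g j > 0 \<longrightarrow> i \<in> g \<inter> U \<longrightarrow> u $ i - \<xi> $ i \<le> u $ j - \<xi> $ j)
     \<and> (\<forall>g\<in>H. (\<Sum>j\<in>UNIV. F g j) < r g \<longrightarrow> (\<forall>i\<in>g \<inter> U. \<xi> $ i = u $ i))"

lemma kktD:
  assumes "kkt u r U H \<xi> F"
  shows "routing H U F"
    and "g \<in> H \<Longrightarrow> (\<Sum>j\<in>UNIV. F g j) \<le> r g"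
    and "j \<in> U \<Longrightarrow> \<xi> $ j = (\<Sum>g\<in>UNIV. F g j)"
    and "j \<in> U \<Longrightarrow> \<xi> $ j \<le> u $ j"
    and "\<lbrakk>F g j > 0; i \<in> g; i \<in> U\<rbrakk> \<Longrightarrow> u $ i - \<xi> $ i \<le> u $ j - \<xi> $ j"
    and "\<lbrakk>g \<in> H; (\<Sum>j\<in>UNIV. F g j) < r g; i \<in> g; i \<in> U\<rbrakk> \<Longrightarrow> \<xi> $ i = u $ i"
proof -
  note A = assms[unfolded kkt_def]
  show "routing H U F" using A by (rule conjunct1)
  show "g \<in> H \<Longrightarrow> (\<Sum>j\<in>UNIV. F g j) \<le> r g" using A by (elim conjE) (rule bspec)
  show "j \<in> U \<Longrightarrow> \<xi> $ j = (\<Sum>g\<in>UNIV. F g j)" using A by (elim conjE) (rule bspec)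
  show "j \<in> U \<Longrightarrow> \<xi> $ j \<le> u $ j" using A by (elim conjE) (rule bspec)
  show "u $ i - \<xi> $ i \<le> u $ j - \<xi> $ j" if "F g j > 0" "i \<in> g" "i \<in> U"
    using A that by (elim conjE) (metis IntI)
  show "\<xi> $ i = u $ i" if "g \<in> H" "(\<Sum>j\<in>UNIV. F g j) < r g" "i \<in> g" "i \<in> U"
    using A that by (elim conjE) (metis IntI)
qed

lemma routing_nonneg: "routing H U F \<Longrightarrow> 0 \<le> F g j"
  and routing_support: "routing H U F \<Longrightarrow> F g j \<noteq> 0 \<Longrightarrow> g \<in> H \<and> j \<in> g \<and> j \<in> U"
  unfolding routing_def by blast+

section \<open>Comparison of a solution with the threshold\<close>

text \<open>If the part of \<open>\<xi>\<close> above the threshold were nonempty, every group meeting it would be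
  saturated and would send all its flow there, whereas \<open>f\<close> routes strictly more to that part.\<close>

lemma kkt_le_threshold:
  fixes f :: "('n::finite) set \<Rightarrow> 'n \<Rightarrow> real"
  assumes K: "kkt u r U H \<xi> F" and "0 \<le> \<tau>"
    and f0: "\<And>g j. 0 \<le> f g j"
    and fs: "\<And>g j. j \<in> U \<Longrightarrow> f g j \<noteq> 0 \<Longrightarrow> g \<in> H \<and> j \<in> g"
    and fr: "\<And>g. g \<in> H \<Longrightarrow> (\<Sum>j\<in>UNIV. f g j) \<le> r g"
    and f\<gamma>: "\<And>j. j \<in> U \<Longrightarrow> (\<Sum>g\<in>UNIV. f g j) = max (u $ j - \<tau>) 0"
    and "j \<in> U"
  shows "u $ j - \<xi> $ j \<le> \<tau>"
proof (rule ccontr)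
  assume neg: "\<not> ?thesis"
  define S where "S = {i \<in> U. \<tau> < u $ i - \<xi> $ i}"
  define HS where "HS = {g \<in> H. g \<inter> S \<noteq> {}}"
  have SU: "S \<subseteq> U" and jS: "j \<in> S" using neg \<open>j \<in> U\<close> by (auto simp: S_def)
  \<comment> \<open>On \<open>S\<close> the defining inequality reads
    \<open>\<xi> $ i < u $ i - \<tau>\<close>.\<close>
  have "(\<Sum>i\<in>S. \<xi> $ i) < (\<Sum>i\<in>S. max (u $ i - \<tau>) 0)"
    by (rule sum_strict_mono) (use jS in \<open>auto simp: S_def\<close>)
  also have "\<dots> = (\<Sum>i\<in>S. \<Sum>g\<in>UNIV. f g i)"
    using f\<gamma> SU by (intro sum.cong) auto
  also have "\<dots> = (\<Sum>g\<in>UNIV. \<Sum>i\<in>S. f g i)"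
    by (rule sum.swap)
  also have "\<dots> = (\<Sum>g\<in>HS. \<Sum>i\<in>S. f g i)"
  proof (rule sum.mono_neutral_right)
    show "\<forall>g\<in>UNIV - HS. (\<Sum>i\<in>S. f g i) = 0"
    proof
      fix g assume "g \<in> UNIV - HS"
      then have "f g i = 0" if "i \<in> S" for i
        using fs[of i g] SU that by (auto simp: HS_def)
      then show "(\<Sum>i\<in>S. f g i) = 0" by simp
    qed
  qed auto
  also have "\<dots> \<le> (\<Sum>g\<in>HS. r g)"
  proof (rule sum_mono)
    fix g assume "g \<in> HS"
    have "(\<Sum>i\<in>S. f g i) \<le> (\<Sum>i\<in>UNIV. f g i)"
      by (rule sum_mono2) (auto simp: f0)
    then show "(\<Sum>i\<in>S. f g i) \<le> r g"
      using fr[of g] \<open>g \<in> HS\<close> by (auto simp: HS_def)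
  qed
  also have "\<dots> \<le> (\<Sum>g\<in>HS. \<Sum>i\<in>S. F g i)"
  proof (rule sum_mono)
    fix g assume g: "g \<in> HS"
    then obtain i where i: "i \<in> g" "i \<in> S" and gH: "g \<in> H" by (auto simp: HS_def)
    \<comment> \<open>Here \<open>u $ i - \<xi> $ i > \<tau> \<ge> 0\<close>, so by slackness
      \<open>g\<close> is saturated. Its mass lands on maximisers of \<open>u - \<xi>\<close> on
      \<open>g\<close>, and these exceed \<open>\<tau>\<close> because \<open>i\<close>
      does.\<close>
    have "\<xi> $ i \<noteq> u $ i" using i \<open>0 \<le> \<tau>\<close> by (auto simp: S_def)
    then have "r g \<le> (\<Sum>k\<in>UNIV. F g k)"
      using kktD(6)[OF K gH _ i(1)] i(2) SU by force
    also have "\<dots> = (\<Sum>k\<in>S. F g k)"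
    proof (rule sum.mono_neutral_right)
      show "\<forall>k\<in>UNIV - S. F g k = 0"
      proof
        fix k assume k: "k \<in> UNIV - S"
        show "F g k = 0"
        proof (rule ccontr)
          assume nz: "F g k \<noteq> 0"
          then have "0 < F g k" "k \<in> U"
            using routing_nonneg[OF kktD(1)[OF K], of g k]
              routing_support[OF kktD(1)[OF K], of g k] by auto
          then show False
            using kktD(5)[OF K, of g k i] i SU k by (auto simp: S_def)
        qed
      qed
    qed auto
    finally show "r g \<le> (\<Sum>k\<in>S. F g k)" .
  qed
  also have "\<dots> \<le> (\<Sum>g\<in>UNIV. \<Sum>i\<in>S. F g i)"
    by (rule sum_mono2) (auto intro!: sum_nonneg routing_nonneg[OF kktD(1)[OF K]])
  also have "\<dots> = (\<Sum>i\<in>S. \<Sum>g\<in>UNIV. F g i)"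
    by (rule sum.swap)
  also have "\<dots> = (\<Sum>i\<in>S. \<xi> $ i)"
    using kktD(3)[OF K] SU by (intro sum.cong) auto
  finally show False by simp
qed

text \<open>Otherwise the groups contained in the part below the threshold are saturated by \<open>f\<close>;
  this forces \<open>\<xi>\<close> and \<open>f\<close> to agree, and in fact to vanish, there, contradicting that some such group exists.\<close>

lemma kkt_ge_threshold:
  fixes f :: "('n::finite) set \<Rightarrow> 'n \<Rightarrow> real"
  assumes K: "kkt u r U H \<xi> F"
    and r: "\<And>g. g \<in> H \<Longrightarrow> 0 < r g"
    and f0: "\<And>g j. 0 \<le> f g j"
    and fs: "\<And>g j. g \<in> H \<Longrightarrow> f g j \<noteq> 0 \<Longrightarrow> j \<in> U \<and> j \<in> g"
    and fr: "\<And>g. g \<in> H \<Longrightarrow> (\<Sum>j\<in>UNIV. f g j) = r g"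
    and f\<gamma>: "\<And>j. j \<in> U \<Longrightarrow> (\<Sum>g\<in>UNIV. f g j) \<le> max (u $ j - \<tau>) 0"
    and "g \<in> H"
  shows "\<exists>j\<in>g \<inter> U. \<tau> \<le> u $ j - \<xi> $ j"
proof (rule ccontr)
  assume neg: "\<not> ?thesis"
  define T where "T = {i \<in> U. u $ i - \<xi> $ i < \<tau>}"
  define HT where "HT = {g \<in> H. g \<inter> U \<subseteq> T}"
  have TU: "T \<subseteq> U" and gHT: "g \<in> HT"
    using neg \<open>g \<in> H\<close> by (auto simp: T_def HT_def not_le)
  have \<xi>0: "0 \<le> \<xi> $ i" if "i \<in> U" for i
    using kktD(3)[OF K that] by (auto intro!: sum_nonneg routing_nonneg[OF kktD(1)[OF K]])
  have "(\<Sum>i\<in>T. \<xi> $ i) = (\<Sum>i\<in>T. \<Sum>g\<in>UNIV. F g i)"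
    using kktD(3)[OF K] TU by (intro sum.cong) auto
  also have "\<dots> = (\<Sum>g\<in>UNIV. \<Sum>i\<in>T. F g i)"
    by (rule sum.swap)
  \<comment> \<open>A group with a variable of \<open>U\<close> outside \<open>T\<close> has its
    maximisers outside \<open>T\<close> and sends nothing into \<open>T\<close>.\<close>
  also have "\<dots> = (\<Sum>g\<in>HT. \<Sum>i\<in>T. F g i)"
  proof (rule sum.mono_neutral_right)
    show "\<forall>g\<in>UNIV - HT. (\<Sum>i\<in>T. F g i) = 0"
    proof
      fix g assume g: "g \<in> UNIV - HT"
      have "F g i = 0" if i: "i \<in> T" for i
      proof (rule ccontr)
        assume nz: "F g i \<noteq> 0"
        then have "0 < F g i" "g \<in> H"
          using routing_nonneg[OF kktD(1)[OF K], of g i]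
            routing_support[OF kktD(1)[OF K], of g i] by auto
        moreover from this g obtain k where "k \<in> g" "k \<in> U" "k \<notin> T"
          by (auto simp: HT_def)
        ultimately show False
          using kktD(5)[OF K, of g i k] i by (auto simp: T_def)
      qed
      then show "(\<Sum>i\<in>T. F g i) = 0" by simp
    qed
  qed auto
  also have "\<dots> \<le> (\<Sum>g\<in>HT. r g)"
  proof (rule sum_mono)
    fix g assume "g \<in> HT"
    have "(\<Sum>i\<in>T. F g i) \<le> (\<Sum>i\<in>UNIV. F g i)"
      by (rule sum_mono2) (auto simp: routing_nonneg[OF kktD(1)[OF K]])
    then show "(\<Sum>i\<in>T. F g i) \<le> r g"
      using kktD(2)[OF K, of g] \<open>g \<in> HT\<close> by (auto simp: HT_def)
  qed
  finally have 1: "(\<Sum>i\<in>T. \<xi> $ i) \<le> (\<Sum>g\<in>HT. r g)" .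
  have "(\<Sum>g\<in>HT. r g) = (\<Sum>g\<in>HT. \<Sum>i\<in>T. f g i)"
  proof (rule sum.cong[OF refl])
    fix g assume g: "g \<in> HT"
    have "(\<Sum>i\<in>UNIV. f g i) = (\<Sum>i\<in>T. f g i)"
      using g fs by (intro sum.mono_neutral_right) (auto simp: HT_def)
    then show "r g = (\<Sum>i\<in>T. f g i)"
      using fr[of g] g by (auto simp: HT_def)
  qed
  also have "\<dots> \<le> (\<Sum>g\<in>UNIV. \<Sum>i\<in>T. f g i)"
    by (rule sum_mono2) (auto intro!: sum_nonneg f0)
  also have "\<dots> = (\<Sum>i\<in>T. \<Sum>g\<in>UNIV. f g i)"
    by (rule sum.swap)
  also have "\<dots> \<le> (\<Sum>i\<in>T. max (u $ i - \<tau>) 0)"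
    using f\<gamma> TU by (intro sum_mono) auto
  finally have 2: "(\<Sum>g\<in>HT. r g) \<le> (\<Sum>i\<in>T. max (u $ i - \<tau>) 0)" .
  have le: "max (u $ i - \<tau>) 0 \<le> \<xi> $ i" if "i \<in> T" for i
    using that \<xi>0[of i] by (auto simp: T_def)
  then have "(\<Sum>i\<in>T. max (u $ i - \<tau>) 0) \<le> (\<Sum>i\<in>T. \<xi> $ i)"
    by (rule sum_mono)
  with 1 2 have eq: "(\<Sum>i\<in>T. \<xi> $ i - max (u $ i - \<tau>) 0) = 0"
    and eq': "(\<Sum>g\<in>HT. r g) = (\<Sum>i\<in>T. \<xi> $ i)"
    by (auto simp: sum_subtractf)
  from eq have "\<forall>i\<in>T. \<xi> $ i - max (u $ i - \<tau>) 0 = 0"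
    using le by (subst (asm) sum_nonneg_eq_0_iff) auto
  \<comment> \<open>On \<open>T\<close> one has \<open>u $ i - \<tau> < \<xi> $ i\<close> strictly,
    so equality with the positive part is possible only at 0.\<close>
  then have "\<xi> $ i = 0" if "i \<in> T" for i
    using that by (force simp: T_def max_def split: if_splits)
  then have "(\<Sum>g\<in>HT. r g) = 0" using eq' by simp
  moreover have "0 < (\<Sum>g\<in>HT. r g)"
    by (rule sum_pos) (use gHT r in \<open>auto simp: HT_def\<close>)
  ultimately show False by simp
qed

text \<open>The assumptions on \<open>f\<close> are what a minimum cut provides. By
  \<open>cut1\<close> the only arcs lost in the split go from a group of \<open>Hm\<close> to a
  variable of \<open>Up\<close>. The threshold comparisons bound \<open>u - \<xi>\<close> from above
  at the head of such an arc and from below at some variable that the group keeps.\<close>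

lemma kkt_glue:
  fixes f :: "('n::finite) set \<Rightarrow> 'n \<Rightarrow> real"
  assumes Kp: "kkt u r Up Hp \<xi>p Fp" and Km: "kkt u r Um Hm \<xi>m Fm"
    and disj: "Up \<inter> Um = {}" "Hp \<inter> Hm = {}"
    and "0 \<le> \<tau>"
    and r: "\<And>g. g \<in> Hm \<Longrightarrow> 0 < r g"
    and f: "routing (Hp \<union> Hm) (Up \<union> Um) f"
    and cut1: "\<And>g j. \<lbrakk>g \<in> Hp; j \<in> g; j \<in> Up \<union> Um\<rbrakk> \<Longrightarrow> j \<in> Up"
    and cut2: "\<And>g j. \<lbrakk>g \<in> Hm; j \<in> Up\<rbrakk> \<Longrightarrow> f g j = 0"
    and satm: "\<And>g. g \<in> Hm \<Longrightarrow> (\<Sum>j\<in>UNIV. f g j) = r g"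
    and capp: "\<And>g. g \<in> Hp \<Longrightarrow> (\<Sum>j\<in>UNIV. f g j) \<le> r g"
    and satp: "\<And>j. j \<in> Up \<Longrightarrow> (\<Sum>g\<in>UNIV. f g j) = max (u $ j - \<tau>) 0"
    and capm: "\<And>j. j \<in> Um \<Longrightarrow> (\<Sum>g\<in>UNIV. f g j) \<le> max (u $ j - \<tau>) 0"
  shows "kkt u r (Up \<union> Um) (Hp \<union> Hm)
    (\<chi> j. if j \<in> Up then \<xi>p $ j else if j \<in> Um then \<xi>m $ j else 0) (\<lambda>g j. Fp g j + Fm g j)"
proof -
  define \<xi> where "\<xi> = (\<chi> j. if j \<in> Up then \<xi>p $ j else if j \<in> Um then \<xi>m $ j else 0)"
  have \<xi>: "\<xi> $ j = \<xi>p $ j" if "j \<in> Up" for j using that by (simp add: \<xi>_def)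
  have \<xi>': "\<xi> $ j = \<xi>m $ j" if "j \<in> Um" for j using that disj by (auto simp: \<xi>_def)
  note Rp = kktD(1)[OF Kp] and Rm = kktD(1)[OF Km]
  \<comment> \<open>By \<open>cut2\<close>, the flow \<open>f\<close> into \<open>Up\<close> comes
    from \<open>Hp\<close> only, and the flow out of \<open>Hm\<close> ends in \<open>Um\<close>
    only; so \<open>f\<close> can be compared with each partial solution separately.\<close>
  have upper: "u $ j - \<xi>p $ j \<le> \<tau>" if "j \<in> Up" for j
    by (rule kkt_le_threshold[OF Kp \<open>0 \<le> \<tau>\<close> _ _ capp satp that])
      (use routing_nonneg[OF f] routing_support[OF f] cut2 in blast)+
  have lower: "\<exists>j\<in>g \<inter> Um. \<tau> \<le> u $ j - \<xi>m $ j" if "g \<in> Hm" for g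
    by (rule kkt_ge_threshold[OF Km r _ _ satm capm that])
      (use routing_nonneg[OF f] routing_support[OF f] cut2 in blast)+
  have Fp0: "Fp g j = 0" if "g \<in> Hm \<or> j \<in> Um" for g j
    using routing_support[OF Rp, of g j] that disj by blast
  have Fm0: "Fm g j = 0" if "g \<in> Hp \<or> j \<in> Up" for g j
    using routing_support[OF Rm, of g j] that disj by blast
  have "routing (Hp \<union> Hm) (Up \<union> Um) (\<lambda>g j. Fp g j + Fm g j)"
    unfolding routing_def
  proof (intro allI conjI impI)
    fix g j
    show "0 \<le> Fp g j + Fm g j" by (simp add: routing_nonneg[OF Rp] routing_nonneg[OF Rm])
    assume "Fp g j + Fm g j \<noteq> 0"
    then have "Fp g j \<noteq> 0 \<or> Fm g j \<noteq> 0" by auto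
    then show "g \<in> Hp \<union> Hm" "j \<in> g" "j \<in> Up \<union> Um"
      using routing_support[OF Rp, of g j] routing_support[OF Rm, of g j] by auto
  qed
  moreover have "(\<Sum>j\<in>UNIV. Fp g j + Fm g j) \<le> r g" if "g \<in> Hp \<union> Hm" for g
    using that
  proof
    assume "g \<in> Hp" then show ?thesis using kktD(2)[OF Kp, of g] by (simp add: Fm0)
  next
    assume "g \<in> Hm" then show ?thesis using kktD(2)[OF Km, of g] by (simp add: Fp0)
  qed
  moreover have "\<xi> $ j = (\<Sum>g\<in>UNIV. Fp g j + Fm g j)" if "j \<in> Up \<union> Um" for j
    using that
  proof
    assume "j \<in> Up" then show ?thesis using kktD(3)[OF Kp, of j] by (simp add: Fm0 \<xi>)
  next
    assume "j \<in> Um" then show ?thesis using kktD(3)[OF Km, of j] by (simp add: Fp0 \<xi>')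
  qed
  moreover have "\<xi> $ j \<le> u $ j" if "j \<in> Up \<union> Um" for j
    using that kktD(4)[OF Kp, of j] kktD(4)[OF Km, of j] \<xi>[of j] \<xi>'[of j] by auto
  moreover have "u $ i - \<xi> $ i \<le> u $ j - \<xi> $ j"
    if F: "0 < Fp g j + Fm g j" and i: "i \<in> g \<inter> (Up \<union> Um)" for g j i
  proof -
    consider (p) "0 < Fp g j" | (m) "0 < Fm g j" using F by linarith
    then show ?thesis
    proof cases
      case p
      then have "g \<in> Hp" "j \<in> Up" using routing_support[OF Rp, of g j] by auto
      then show ?thesis
        using kktD(5)[OF Kp p, of i] cut1[of g i] i \<xi>[of i] \<xi>[of j] by auto
    next
      case m
      then have g: "g \<in> Hm" and j: "j \<in> Um" using routing_support[OF Rm, of g j] by auto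
      show ?thesis
      proof (cases "i \<in> Um")
        case True
        then show ?thesis using kktD(5)[OF Km m, of i] i \<xi>'[of i] \<xi>'[OF j] by auto
      next
        case False
        \<comment> \<open>The arc from \<open>g\<close> to \<open>i\<close> was discarded. With
          \<open>w = u - \<xi>\<close>, the chain is
          \<open>w $ i \<le> \<tau> \<le> w $ k \<le> w $ j\<close>.\<close>
        then have "i \<in> Up" using i by auto
        moreover obtain k where "k \<in> g" "k \<in> Um" "\<tau> \<le> u $ k - \<xi>m $ k"
          using lower[OF g] by auto
        ultimately show ?thesis
          using kktD(5)[OF Km m, of k] upper[of i] \<xi>[of i] \<xi>'[OF j] by auto
      qed
    qed
  qed
  moreover have "\<xi> $ i = u $ i"
    if g: "g \<in> Hp \<union> Hm" and less: "(\<Sum>j\<in>UNIV. Fp g j + Fm g j) < r g"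
      and i: "i \<in> g \<inter> (Up \<union> Um)" for g i
    using g
  proof
    assume g: "g \<in> Hp"
    then show ?thesis
      using kktD(6)[OF Kp g, of i] cut1[of g i] i less \<xi>[of i] by (auto simp: Fm0)
  next
    assume g: "g \<in> Hm"
    then have less': "(\<Sum>j\<in>UNIV. Fm g j) < r g" using less by (simp add: Fp0)
    show ?thesis
    proof (cases "i \<in> Um")
      case True
      then show ?thesis using kktD(6)[OF Km g less', of i] i \<xi>'[of i] by auto
    next
      case False
      \<comment> \<open>Slackness on the sink side gives \<open>w $ k = 0\<close> for
        \<open>w = u - \<xi>\<close>, hence
        \<open>0 \<le> w $ i \<le> \<tau> \<le> w $ k = 0\<close>.\<close>
      then have "i \<in> Up" using i by auto
      moreover obtain k where "k \<in> g" "k \<in> Um" "\<tau> \<le> u $ k - \<xi>m $ k"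
        using lower[OF g] by auto
      ultimately show ?thesis
        using kktD(6)[OF Km g less', of k] upper[of i] \<xi>[of i] kktD(4)[OF Kp, of i]  by auto
    qed
  qed
  ultimately show ?thesis
    unfolding kkt_def \<xi>_def[symmetric] by blast
qed

text \<open>On \<open>U\<close>, \<open>u - \<xi>\<close> is the minimum of \<open>u\<close> and
  \<open>\<tau>\<close>. A charged variable has \<open>\<xi> $ j > 0\<close> and thus attains the
  largest possible value \<open>\<tau>\<close>. An unsaturated group makes the total load smaller
  than the total capacity, so \<open>tight\<close> leaves only \<open>\<tau> = 0\<close>, where
  \<open>\<xi> = u\<close>.\<close>

lemma kkt_threshold:
  fixes f :: "('n::finite) set \<Rightarrow> 'n \<Rightarrow> real"
  assumes u: "\<And>j. 0 \<le> u $ j" and "0 \<le> \<tau>"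
    and f: "routing H U f"
    and cap: "\<And>g. g \<in> H \<Longrightarrow> (\<Sum>j\<in>UNIV. f g j) \<le> r g"
    and \<xi>: "\<And>j. j \<in> U \<Longrightarrow> \<xi> $ j = max (u $ j - \<tau>) 0"
    and load: "\<And>j. j \<in> U \<Longrightarrow> \<xi> $ j = (\<Sum>g\<in>UNIV. f g j)"
    and tight: "\<tau> = 0 \<or> (\<Sum>j\<in>U. \<xi> $ j) = (\<Sum>g\<in>H. r g)"
  shows "kkt u r U H \<xi> f"
proof -
  have le: "\<xi> $ j \<le> u $ j" if "j \<in> U" for j
    using \<xi>[OF that] u[of j] \<open>0 \<le> \<tau>\<close> by (auto simp: max_def)
  have mx: "u $ i - \<xi> $ i \<le> u $ j - \<xi> $ j" if F: "f g j > 0" and i: "i \<in> g \<inter> U" for g j i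
  proof -
    have j: "j \<in> U" using F routing_support[OF f, of g j] by auto
    have "f g j \<le> (\<Sum>g\<in>UNIV. f g j)"
      by (rule member_le_sum) (auto intro: routing_nonneg[OF f])
    then have "0 < \<xi> $ j" using F load[OF j] by simp
    then show ?thesis using \<xi>[OF j] \<xi>[of i] i by (auto simp: max_def split: if_splits)
  qed
  have un: "\<xi> $ i = u $ i" if g: "g \<in> H" and less: "(\<Sum>j\<in>UNIV. f g j) < r g" and i: "i \<in> g \<inter> U" for g i
  proof -
    have "(\<Sum>j\<in>U. \<xi> $ j) = (\<Sum>j\<in>U. \<Sum>g\<in>UNIV. f g j)"
      using load by (intro sum.cong) auto
    also have "\<dots> = (\<Sum>g\<in>UNIV. \<Sum>j\<in>U. f g j)" by (rule sum.swap)
    also have "\<dots> = (\<Sum>g\<in>H. \<Sum>j\<in>U. f g j)"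
      using routing_support[OF f] by (intro sum.mono_neutral_right) (auto intro!: sum.neutral)
    also have "\<dots> = (\<Sum>g\<in>H. \<Sum>j\<in>UNIV. f g j)"
      using routing_support[OF f] by (intro sum.cong sum.mono_neutral_left) auto
    also have "\<dots> < (\<Sum>g\<in>H. r g)"
      by (rule sum_strict_mono_ex1) (use g less cap in auto)
    finally have "\<tau> = 0" using tight by simp
    then show ?thesis using \<xi>[of i] i u[of i] by auto
  qed
  show ?thesis
    unfolding kkt_def using f cap load le mx un by blast
qed

section \<open>The projection step\<close>

text \<open>The mass above \<open>\<tau>\<close> depends continuously on \<open>\<tau>\<close> and
  eventually drops to 0, so the intermediate value theorem applies when the budget is exceeded at 0.
  The disjunction is complementary slackness for the budget.\<close>

lemma threshold_exists:
  fixes u :: "real ^ ('n::finite)"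
  assumes "0 \<le> b"
  shows "\<exists>\<tau>\<ge>0. (\<Sum>j\<in>U. max (u $ j - \<tau>) 0) \<le> b \<and> (\<tau> = 0 \<or> (\<Sum>j\<in>U. max (u $ j - \<tau>) 0) = b)"
proof (cases "(\<Sum>j\<in>U. max (u $ j - 0) 0) \<le> b")
  case True
  then show ?thesis by (intro exI[of _ 0]) auto
next
  case False
  \<comment> \<open>Any nonnegative upper bound of all entries of \<open>u\<close> serves as the
    right end of the interval.\<close>
  define m where "m = (\<Sum>j\<in>UNIV. \<bar>u $ j\<bar>)"
  have "u $ j \<le> m" for j
    using member_le_sum[of j UNIV "\<lambda>j. \<bar>u $ j\<bar>"] by (auto simp: m_def)
  then have "(\<Sum>j\<in>U. max (u $ j - m) 0) = 0"
    by (intro sum.neutral) (auto simp: max_def)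
  moreover have "0 \<le> m" by (auto simp: m_def intro: sum_nonneg)
  ultimately have "\<exists>\<tau>\<ge>0. \<tau> \<le> m \<and> (\<Sum>j\<in>U. max (u $ j - \<tau>) 0) = b"
    using False assms by (intro IVT2') (auto intro!: continuous_intros)
  then show ?thesis by auto
qed

text \<open>\<open>\<tau>\<close> is the Lagrange multiplier of the budget constraint. The quadratic
  surplus in \<open>gap\<close> makes the minimiser unique, as the definite description in
  \<open>projection\<close> requires.\<close>

lemma projection_threshold:
  fixes u :: "real ^ ('n::finite)"
  assumes \<tau>: "0 \<le> \<tau>" and le: "(\<Sum>j\<in>U. max (u $ j - \<tau>) 0) \<le> b"
    and tight: "\<tau> = 0 \<or> (\<Sum>j\<in>U. max (u $ j - \<tau>) 0) = b"
  shows "projection u U b = (\<chi> j. if j \<in> U then max (u $ j - \<tau>) 0 else 0)"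
proof -
  define \<gamma> where "\<gamma> = (\<chi> j. if j \<in> U then max (u $ j - \<tau>) 0 else 0)"
  define feas where "feas = (\<lambda>\<delta> :: real ^ 'n. (\<forall>j\<in>U. 0 \<le> \<delta> $ j) \<and> (\<Sum>j\<in>U. \<delta> $ j) \<le> b \<and> (\<forall>j. j \<notin> U \<longrightarrow> \<delta> $ j = 0))"
  define obj where "obj = (\<lambda>\<delta> :: real ^ 'n. \<Sum>j\<in>U. 1 / 2 * (u $ j - \<delta> $ j)\<^sup>2)"
  have \<gamma>: "\<gamma> $ j = max (u $ j - \<tau>) 0" if "j \<in> U" for j
    using that by (simp add: \<gamma>_def)
  have feas\<gamma>: "feas \<gamma>" using le by (auto simp: feas_def \<gamma>_def)
  have gap: "obj \<gamma> + (\<Sum>j\<in>U. 1 / 2 * (\<delta> $ j - \<gamma> $ j)\<^sup>2) \<le> obj \<delta>" if \<delta>: "feas \<delta>" for \<delta>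
  proof -
    \<comment> \<open>Where \<open>u $ j > \<tau>\<close>, the first factor equals
      \<open>\<tau>\<close>; elsewhere it is at most \<open>\<tau>\<close> and
      \<open>\<gamma> $ j = 0 \<le> \<delta> $ j\<close>. The bound is nonpositive since
      \<open>\<tau> = 0\<close> or \<open>\<gamma>\<close> exhausts the budget that
      \<open>\<delta>\<close> respects.\<close>
    have "(\<Sum>j\<in>U. (u $ j - \<gamma> $ j) * (\<delta> $ j - \<gamma> $ j)) \<le> (\<Sum>j\<in>U. \<tau> * (\<delta> $ j - \<gamma> $ j))"
    proof (rule sum_mono)
      fix j assume j: "j \<in> U"
      then have "0 \<le> \<delta> $ j" using \<delta> by (auto simp: feas_def)
      then show "(u $ j - \<gamma> $ j) * (\<delta> $ j - \<gamma> $ j) \<le> \<tau> * (\<delta> $ j - \<gamma> $ j)"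
        by (cases "u $ j \<le> \<tau>") (auto simp: \<gamma>[OF j] intro: mult_right_mono)
    qed
    also have "\<dots> = \<tau> * ((\<Sum>j\<in>U. \<delta> $ j) - (\<Sum>j\<in>U. \<gamma> $ j))"
      by (simp add: sum_distrib_left[symmetric] sum_subtractf)
    also have "\<dots> \<le> 0"
    proof -
      have "(\<Sum>j\<in>U. \<gamma> $ j) = (\<Sum>j\<in>U. max (u $ j - \<tau>) 0)"
        by (rule sum.cong) (auto simp: \<gamma>)
      then show ?thesis
        using tight \<tau> \<delta> by (auto simp: feas_def mult_nonneg_nonpos)
    qed
    finally have "(\<Sum>j\<in>U. (u $ j - \<gamma> $ j) * (\<delta> $ j - \<gamma> $ j)) \<le> 0" .
    moreover have "obj \<delta> = obj \<gamma> + (\<Sum>j\<in>U. 1 / 2 * (\<delta> $ j - \<gamma> $ j)\<^sup>2)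
        - (\<Sum>j\<in>U. (u $ j - \<gamma> $ j) * (\<delta> $ j - \<gamma> $ j))"
      unfolding obj_def sum.distrib[symmetric] sum_subtractf[symmetric]
      by (intro sum.cong) (auto simp: power2_eq_square field_simps)
    ultimately show ?thesis by linarith
  qed
  have "(THE \<delta>. is_arg_min obj feas \<delta>) = \<gamma>"
  proof (rule the_equality)
    have "obj \<gamma> \<le> obj \<delta>" if "feas \<delta>" for \<delta>
      using gap[OF that] sum_nonneg[of U "\<lambda>j. 1 / 2 * (\<delta> $ j - \<gamma> $ j)\<^sup>2"] by auto
    then show "is_arg_min obj feas \<gamma>"
      using feas\<gamma> by (auto simp: is_arg_min_def not_less)
    fix \<delta> assume "is_arg_min obj feas \<delta>"
    then have f: "feas \<delta>" and "obj \<delta> \<le> obj \<gamma>"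
      using feas\<gamma> by (auto simp: is_arg_min_def not_less)
    then have "(\<Sum>j\<in>U. 1 / 2 * (\<delta> $ j - \<gamma> $ j)\<^sup>2) = 0"
      using gap[OF f] by (intro antisym sum_nonneg) auto
    then have "\<forall>j\<in>U. 1 / 2 * (\<delta> $ j - \<gamma> $ j)\<^sup>2 = 0"
      by (subst (asm) sum_nonneg_eq_0_iff) auto
    then show "\<delta> = \<gamma>"
      using f by (auto simp: vec_eq_iff feas_def \<gamma>_def)
  qed
  then show ?thesis
    unfolding projection_def \<gamma>_def obj_def feas_def by simp
qed

section \<open>Maximum flows\<close>

text \<open>Net outflow is linear and makes sense for directions with negative entries. It expresses
  conservation at inner vertices and equals \<open>flow_value\<close> at the source.\<close>

definition net :: "('v \<times> 'v) set \<Rightarrow> ('v \<times> 'v \<Rightarrow> real) \<Rightarrow> 'v \<Rightarrow> real" where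
  "net E d v = (\<Sum>e | e \<in> E \<and> fst e = v. d e) - (\<Sum>e | e \<in> E \<and> snd e = v. d e)"

lemma net_add_mult:
  "net E (\<lambda>e. f e + k * d e) v = net E f v + k * net E d v"
  unfolding net_def sum.distrib sum_distrib_left[symmetric] by (simp add: algebra_simps)

lemma net_single:
  assumes "finite E" "(x, y) \<in> E"
  shows "net E (\<lambda>e. of_bool (e = (x, y))) v = of_bool (v = x) - of_bool (v = y)"
proof -
  have "(\<Sum>e | e \<in> E \<and> P e. of_bool (e = (x, y))) = (of_bool (P (x, y)) :: real)" for P
  proof -
    have "{e. e \<in> E \<and> P e} \<inter> {e. e = (x, y)} = (if P (x, y) then {(x, y)} else {})"
      using assms by auto
    then show ?thesis using assms by (simp add: sum.If_cases of_bool_def)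
  qed
  then show ?thesis by (auto simp: net_def)
qed

text \<open>Adding up the arc directions along a residual walk keeps the signs compatible with the
  residual graph, even if the walk uses an arc several times or in both directions.\<close>

lemma residual_direction:
  assumes "finite E" and "(s, v) \<in> (residual_arcs E c f)\<^sup>*"
  shows "\<exists>d. (\<forall>e\<in>E. 0 < d e \<longrightarrow> ereal (f e) < c e) \<and> (\<forall>e\<in>E. d e < 0 \<longrightarrow> 0 < f e)
    \<and> (\<forall>x. net E d x = of_bool (x = s) - of_bool (x = v))"
  using assms(2)
proof (induction rule: rtrancl_induct)
  case base
  show ?case by (rule exI[of _ "\<lambda>_. 0"]) (simp add: net_def)
next
  case (step v w)
  then obtain d where d: "\<forall>e\<in>E. 0 < d e \<longrightarrow> ereal (f e) < c e" "\<forall>e\<in>E. d e < 0 \<longrightarrow> 0 < f e"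
    "\<forall>x. net E d x = of_bool (x = s) - of_bool (x = v)"
    by blast
  from step(2) consider (fw) "(v, w) \<in> E" "ereal (f (v, w)) < c (v, w)" | (bw) "(w, v) \<in> E" "0 < f (w, v)"
    by (auto simp: residual_arcs_def)
  then show ?case
  proof cases
    case fw
    let ?d = "\<lambda>e. d e + 1 * of_bool (e = (v, w))"
    have "net E ?d x = of_bool (x = s) - of_bool (x = w)" for x
      unfolding net_add_mult net_single[OF assms(1) fw(1)] using d(3) by simp
    moreover have "\<forall>e\<in>E. 0 < ?d e \<longrightarrow> ereal (f e) < c e" "\<forall>e\<in>E. ?d e < 0 \<longrightarrow> 0 < f e"
      using d(1,2) fw by (auto simp: of_bool_def)
    ultimately show ?thesis by (intro exI[of _ ?d]) blast
  next
    case bw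
    let ?d = "\<lambda>e. d e + (-1) * of_bool (e = (w, v))"
    have "net E ?d x = of_bool (x = s) - of_bool (x = w)" for x
      unfolding net_add_mult net_single[OF assms(1) bw(1)] using d(3) by simp
    moreover have "\<forall>e\<in>E. 0 < ?d e \<longrightarrow> ereal (f e) < c e" "\<forall>e\<in>E. ?d e < 0 \<longrightarrow> 0 < f e"
      using d(1,2) bw by (auto simp: of_bool_def)
    ultimately show ?thesis by (intro exI[of _ ?d]) blast
  qed
qed

text \<open>A residual path to \<open>t\<close> yields a direction with net outflow 1 at
  \<open>s\<close>; adding a small positive multiple of it to \<open>f\<close> keeps a flow and
  increases its value.\<close>

lemma max_flow_no_augmenting_path:
  assumes "finite E" and "s \<noteq> t" and mx: "is_max_flow s t V E c f"
  shows "(s, t) \<notin> (residual_arcs E c f)\<^sup>*"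
proof
  assume "(s, t) \<in> (residual_arcs E c f)\<^sup>*"
  from residual_direction[OF \<open>finite E\<close> this] obtain d
    where d: "\<forall>e\<in>E. 0 < d e \<longrightarrow> ereal (f e) < c e" "\<forall>e\<in>E. d e < 0 \<longrightarrow> 0 < f e"
      "\<forall>x. net E d x = of_bool (x = s) - of_bool (x = t)"
    by blast
  have fl: "is_flow s t V E c f" using mx by (simp add: is_max_flow_def)
  \<comment> \<open>This replaces the bottleneck capacity: each arc constraint survives for all
    small \<open>k > 0\<close>, and there are finitely many arcs.\<close>
  have "\<forall>e\<in>E. \<forall>\<^sub>F k in at_right 0. 0 \<le> f e + k * d e \<and> ereal (f e + k * d e) \<le> c e"
  proof
    fix e assume e: "e \<in> E"
    have lim: "((\<lambda>k. f e + k * d e) \<longlongrightarrow> f e) (at_right 0)"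
      by (auto intro!: tendsto_eq_intros)
    have pos: "\<forall>\<^sub>F k :: real in at_right 0. 0 < k"
      by (simp add: eventually_at_right_less)
    have fe: "0 \<le> f e" "ereal (f e) \<le> c e" using fl e by (auto simp: is_flow_def)
    consider "d e = 0" | "0 < d e" | "d e < 0" by linarith
    then show "\<forall>\<^sub>F k in at_right 0. 0 \<le> f e + k * d e \<and> ereal (f e + k * d e) \<le> c e"
    proof cases
      case 1
      then show ?thesis using fe by simp
    next
      case 2
      \<comment> \<open>The capacity may be infinite, so a real number strictly below it is used as
        the bound.\<close>
      then obtain m where m: "ereal (f e) < ereal m" "ereal m < c e"
        using d(1) e ereal_dense2 by blast
      then have "\<forall>\<^sub>F k in at_right 0. f e + k * d e < m"
        using order_tendstoD(2)[OF lim] by simp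
      with pos show ?thesis
      proof eventually_elim
        case (elim k)
        then have "ereal (f e + k * d e) \<le> ereal m" by simp
        also have "\<dots> \<le> c e" using m by simp
        finally show ?case using elim 2 fe by simp
      qed
    next
      case 3
      then have "\<forall>\<^sub>F k in at_right 0. 0 < f e + k * d e"
        using order_tendstoD(1)[OF lim] d(2) e by simp
      with pos show ?thesis
      proof eventually_elim
        case (elim k)
        have "ereal (f e + k * d e) \<le> ereal (f e)"
          using elim 3 by (simp add: mult_pos_neg less_imp_le)
        also have "\<dots> \<le> c e" by (rule fe)
        finally show ?case using elim by simp
      qed
    qed
  qed
  then have "\<forall>\<^sub>F k in at_right 0. \<forall>e\<in>E. 0 \<le> f e + k * d e \<and> ereal (f e + k * d e) \<le> c e"
    by (rule eventually_ball_finite[OF \<open>finite E\<close>])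
  moreover have "\<forall>\<^sub>F k :: real in at_right 0. 0 < k"
    by (simp add: eventually_at_right_less)
  ultimately have ev: "\<forall>\<^sub>F k in at_right 0. 0 < k \<and> (\<forall>e\<in>E. 0 \<le> f e + k * d e \<and> ereal (f e + k * d e) \<le> c e)"
    by eventually_elim auto
  obtain k where k: "0 < k" "\<forall>e\<in>E. 0 \<le> f e + k * d e \<and> ereal (f e + k * d e) \<le> c e"
    using eventually_happens'[OF trivial_limit_at_right_real ev] by blast
  let ?f = "\<lambda>e. f e + k * d e"
  have "net E ?f v = 0" if "v \<in> V - {s, t}" for v
  proof -
    have "net E f v = 0" using fl that by (auto simp: is_flow_def net_def)
    then show ?thesis using d(3) that by (auto simp: net_add_mult)
  qed
  then have "is_flow s t V E c ?f"
    unfolding is_flow_def net_def using k(2) by force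
  then have "flow_value s E ?f \<le> flow_value s E f"
    using mx by (simp add: is_max_flow_def)
  moreover have "flow_value s E ?f = flow_value s E f + k"
    using net_add_mult[of E f k d s] d(3) \<open>s \<noteq> t\<close> by (simp add: net_def flow_value_def)
  ultimately show False using k(1) by simp
qed

section \<open>Existence of maximum flows\<close>

lemma is_flow_cong:
  assumes "\<And>e. e \<in> E \<Longrightarrow> f e = f' e"
  shows "is_flow s t V E c f = is_flow s t V E c f'" and "flow_value s E f = flow_value s E f'"
proof -
  have *: "(\<Sum>e | e \<in> E \<and> P e. f e) = (\<Sum>e | e \<in> E \<and> P e. f' e)" for P
    using assms by (intro sum.cong) auto
  show "is_flow s t V E c f = is_flow s t V E c f'"
    unfolding is_flow_def * using assms by simp
  show "flow_value s E f = flow_value s E f'"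
    unfolding flow_value_def * ..
qed

text \<open>The value is a continuous function on a compact set of flows. Infinite capacities give
  no bound, hence the a priori bound \<open>M\<close>.\<close>

lemma max_flow_exists:
  fixes c :: "'v \<times> 'v \<Rightarrow> ereal"
  assumes zero: "is_flow s t V E c f0"
    and bdd: "\<And>f e. is_flow s t V E c f \<Longrightarrow> e \<in> E \<Longrightarrow> f e \<le> M"
  shows "\<exists>f. is_max_flow s t V E c f"
proof -
  \<comment> \<open>Pinning the values off \<open>E\<close> to 0 gives a product of compact sets,
    compact by Tychonoff. Clipping moves any flow into this box without changing its value.\<close>
  define B where "B = (\<Pi>\<^sub>E e\<in>UNIV. if e \<in> E then {0..M} else {0 :: real})"
  define K where "K = B \<inter> {f. is_flow s t V E c f}"
  have "compactin (product_topology (\<lambda>_. euclidean) UNIV) B"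
    unfolding B_def compactin_PiE by auto
  then have "compact B"
    by (simp add: euclidean_product_topology)
  moreover have "closed {f. is_flow s t V E c f}"
    unfolding is_flow_def Ball_def
    by (intro closed_Collect_conj closed_Collect_all closed_Collect_imp closed_Collect_le
        closed_Collect_eq open_Collect_const continuous_on_sum continuous_on_ereal continuous_intros
        continuous_on_product_coordinates)
  ultimately have "compact K" unfolding K_def by (rule compact_Int_closed)
  define clip where "clip = (\<lambda>(f :: 'v \<times> 'v \<Rightarrow> real) e. if e \<in> E then f e else 0)"
  have clip: "clip f \<in> K" "flow_value s E (clip f) = flow_value s E f" if f: "is_flow s t V E c f" for f
  proof -
    have eq: "\<And>e. e \<in> E \<Longrightarrow> clip f e = f e" by (simp add: clip_def)
    have "clip f \<in> B"
      using f bdd[OF f] by (auto simp: B_def clip_def is_flow_def)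
    then show "clip f \<in> K"
      using f is_flow_cong(1)[of E "clip f" f, OF eq] by (simp add: K_def)
    show "flow_value s E (clip f) = flow_value s E f"
      by (rule is_flow_cong(2)[of E "clip f" f, OF eq])
  qed
  have "continuous_on K (flow_value s E)"
    unfolding flow_value_def
    by (intro continuous_intros continuous_on_subset[OF continuous_on_product_coordinates]) auto
  then obtain f where f: "f \<in> K" "\<forall>g\<in>K. flow_value s E g \<le> flow_value s E f"
    using continuous_attains_sup[OF \<open>compact K\<close>] clip[OF zero] by blast
  have "is_max_flow s t V E c f"
    unfolding is_max_flow_def
  proof (intro conjI allI impI)
    show "is_flow s t V E c f" using f(1) by (simp add: K_def)
    show "flow_value s E g \<le> flow_value s E f" if "is_flow s t V E c g" for g
      using f(2) clip[OF that] by metis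
  qed
  then show ?thesis by blast
qed

section \<open>Flows on the canonical graph\<close>

text \<open>This is the induced subgraph together with source and sink. It is stable under
  \<open>restrict_arcs\<close>, so in every recursive call the arcs are determined by the vertices
  and the induction can run over vertex sets.\<close>

definition arcs_on :: "'n node set \<Rightarrow> ('n node \<times> 'n node) set" where
  "arcs_on V =
     {(Source, Group g) | g. g \<in> groups V} \<union>
     {(Group g, Var j) | g j. g \<in> groups V \<and> j \<in> g \<and> j \<in> vars V} \<union>
     {(Var j, Sink) | j. j \<in> vars V}"

lemma canonical_arcs_eq: "canonical_arcs \<G> = arcs_on (canonical_verts \<G>)"
  by (auto simp: canonical_arcs_def arcs_on_def canonical_verts_def vars_def groups_def)

lemma restrict_arcs_on:
  assumes "W \<subseteq> V" "Source \<notin> V" "Sink \<notin> V"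
  shows "restrict_arcs W (arcs_on V) = arcs_on W"
  using assms by (auto simp: restrict_arcs_def arcs_on_def vars_def groups_def)

lemma finite_nodes: "finite (V :: ('n::finite) node set)"
proof (rule finite_subset)
  show "V \<subseteq> {Source, Sink} \<union> range Var \<union> range Group"
  proof
    fix x :: "'n node" show "x \<in> {Source, Sink} \<union> range Var \<union> range Group" by (cases x) auto
  qed
qed simp

lemma finite_arcs_on: "finite (arcs_on (V :: ('n::finite) node set))"
  by (rule finite_subset[of _ "UNIV \<times> UNIV"]) (simp, intro finite_cartesian_product finite_nodes)

lemma arcs_at:
  shows "g \<in> groups V \<Longrightarrow> {e. e \<in> arcs_on V \<and> snd e = Group g} = {(Source, Group g)}"
    and "g \<in> groups V \<Longrightarrow> {e. e \<in> arcs_on V \<and> fst e = Group g} = (\<lambda>j. (Group g, Var j)) ` (g \<inter> vars V)"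
    and "j \<in> vars V \<Longrightarrow> {e. e \<in> arcs_on V \<and> snd e = Var j} = (\<lambda>g. (Group g, Var j)) ` {g \<in> groups V. j \<in> g}"
    and "j \<in> vars V \<Longrightarrow> {e. e \<in> arcs_on V \<and> fst e = Var j} = {(Var j, Sink)}"
  by (auto simp: arcs_on_def)

text \<open>The middle layer of a flow, padded by 0 to form a routing. Conservation turns its row
  sums into source flows and its column sums into sink flows.\<close>

definition flow_matrix :: "'n node set \<Rightarrow> ('n node \<times> 'n node \<Rightarrow> real) \<Rightarrow> 'n set \<Rightarrow> 'n \<Rightarrow> real" where
  "flow_matrix V f g j = (if g \<in> groups V \<and> j \<in> g \<and> j \<in> vars V then f (Group g, Var j) else 0)"

lemma flow_matrix:
  fixes V :: "('n::finite) node set"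
  assumes f: "is_flow Source Sink (V \<union> {Source, Sink}) (arcs_on V) c f"
  shows "routing (groups V) (vars V) (flow_matrix V f)"
    and "g \<in> groups V \<Longrightarrow> (\<Sum>j\<in>UNIV. flow_matrix V f g j) = f (Source, Group g)"
    and "j \<in> vars V \<Longrightarrow> (\<Sum>g\<in>UNIV. flow_matrix V f g j) = f (Var j, Sink)"
proof -
  show "routing (groups V) (vars V) (flow_matrix V f)"
    using f by (auto simp: routing_def flow_matrix_def is_flow_def arcs_on_def)
  show "(\<Sum>j\<in>UNIV. flow_matrix V f g j) = f (Source, Group g)" if g: "g \<in> groups V"
  proof -
    have "(\<Sum>j\<in>UNIV. flow_matrix V f g j) = (\<Sum>j\<in>g \<inter> vars V. f (Group g, Var j))"
      using g by (intro sum.mono_neutral_cong_right) (auto simp: flow_matrix_def)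
    also have "\<dots> = (\<Sum>e | e \<in> arcs_on V \<and> fst e = Group g. f e)"
      unfolding arcs_at(2)[OF g] by (subst sum.reindex) (auto simp: inj_on_def)
    also have "\<dots> = (\<Sum>e | e \<in> arcs_on V \<and> snd e = Group g. f e)"
      using f g by (simp add: is_flow_def groups_def)
    finally show ?thesis unfolding arcs_at(1)[OF g] by simp
  qed
  show "(\<Sum>g\<in>UNIV. flow_matrix V f g j) = f (Var j, Sink)" if j: "j \<in> vars V"
  proof -
    have "(\<Sum>g\<in>UNIV. flow_matrix V f g j) = (\<Sum>g | g \<in> groups V \<and> j \<in> g. f (Group g, Var j))"
      using j by (intro sum.mono_neutral_cong_right) (auto simp: flow_matrix_def)
    also have "\<dots> = (\<Sum>e | e \<in> arcs_on V \<and> snd e = Var j. f e)"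
      unfolding arcs_at(3)[OF j] by (subst sum.reindex) (auto simp: inj_on_def)
    also have "\<dots> = (\<Sum>e | e \<in> arcs_on V \<and> fst e = Var j. f e)"
      using f j by (simp add: is_flow_def vars_def)
    finally show ?thesis unfolding arcs_at(4)[OF j] by simp
  qed
qed

text \<open>Double counting of the middle layer; it converts a deficit on a sink arc into slack on a
  source arc.\<close>

lemma sum_source_eq_sum_sink:
  fixes V :: "('n::finite) node set"
  assumes f: "is_flow Source Sink (V \<union> {Source, Sink}) (arcs_on V) c f"
  shows "(\<Sum>g\<in>groups V. f (Source, Group g)) = (\<Sum>j\<in>vars V. f (Var j, Sink))"
proof -
  note F = flow_matrix[OF f]
  have "(\<Sum>g\<in>groups V. f (Source, Group g)) = (\<Sum>g\<in>groups V. \<Sum>j\<in>UNIV. flow_matrix V f g j)"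
    using F(2) by (intro sum.cong) auto
  also have "\<dots> = (\<Sum>g\<in>UNIV. \<Sum>j\<in>UNIV. flow_matrix V f g j)"
    by (intro sum.mono_neutral_left) (auto simp: flow_matrix_def)
  also have "\<dots> = (\<Sum>j\<in>UNIV. \<Sum>g\<in>UNIV. flow_matrix V f g j)"
    by (rule sum.swap)
  also have "\<dots> = (\<Sum>j\<in>vars V. \<Sum>g\<in>UNIV. flow_matrix V f g j)"
    by (intro sum.mono_neutral_right) (auto simp: flow_matrix_def)
  also have "\<dots> = (\<Sum>j\<in>vars V. f (Var j, Sink))"
    using F(3) by (intro sum.cong) auto
  finally show ?thesis .
qed

lemma set_sink_caps_simps:
  "set_sink_caps U \<gamma> (canonical_cap lam \<eta>) (Source, Group g) = ereal (lam * \<eta> g)"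
  "set_sink_caps U \<gamma> (canonical_cap lam \<eta>) (Group g, Var j) = \<infinity>"
  "j \<in> U \<Longrightarrow> set_sink_caps U \<gamma> (canonical_cap lam \<eta>) (Var j, Sink) = ereal (\<gamma> $ j)"
  by (auto simp: set_sink_caps_def)

text \<open>Conservation bounds the flow on an arc of infinite capacity by the flow entering its
  group, so the sum of all finite capacities bounds every arc.\<close>

lemma canonical_max_flow_exists:
  fixes V :: "('n::finite) node set"
  assumes r: "\<And>g. g \<in> groups V \<Longrightarrow> 0 \<le> lam * \<eta> g"
    and \<gamma>: "\<And>j. j \<in> vars V \<Longrightarrow> 0 \<le> \<gamma> $ j"
  shows "\<exists>f. is_max_flow Source Sink (V \<union> {Source, Sink}) (arcs_on V)
    (set_sink_caps (vars V) \<gamma> (canonical_cap lam \<eta>)) f"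
proof (rule max_flow_exists)
  show "is_flow Source Sink (V \<union> {Source, Sink}) (arcs_on V)
    (set_sink_caps (vars V) \<gamma> (canonical_cap lam \<eta>)) (\<lambda>_. 0)"
    using r \<gamma> by (auto simp: is_flow_def arcs_on_def set_sink_caps_simps)
  fix f e
  assume f: "is_flow Source Sink (V \<union> {Source, Sink}) (arcs_on V)
    (set_sink_caps (vars V) \<gamma> (canonical_cap lam \<eta>)) f" and e: "e \<in> arcs_on V"
  let ?A = "\<Sum>g\<in>groups V. lam * \<eta> g" and ?B = "\<Sum>j\<in>vars V. \<gamma> $ j"
  have cap: "f a \<ge> 0" "ereal (f a) \<le> set_sink_caps (vars V) \<gamma> (canonical_cap lam \<eta>) a" if "a \<in> arcs_on V" for a
    using f that by (auto simp: is_flow_def)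
  have AB: "0 \<le> ?A" "0 \<le> ?B" using r \<gamma> by (auto intro: sum_nonneg)
  have src: "f (Source, Group g) \<le> ?A" if g: "g \<in> groups V" for g
  proof -
    have "f (Source, Group g) \<le> lam * \<eta> g"
      using cap(2)[of "(Source, Group g)"] g by (auto simp: arcs_on_def set_sink_caps_simps)
    also have "\<dots> \<le> ?A" by (rule member_le_sum) (use g r in auto)
    finally show ?thesis .
  qed
  from e consider (s) g where "e = (Source, Group g)" "g \<in> groups V"
    | (m) g j where "e = (Group g, Var j)" "g \<in> groups V" "j \<in> g" "j \<in> vars V"
    | (t) j where "e = (Var j, Sink)" "j \<in> vars V"
    by (auto simp: arcs_on_def)
  then show "f e \<le> ?A + ?B"
  proof cases
    case s
    then show ?thesis using src AB by force
  next
    case m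
    have "f e = flow_matrix V f g j" using m by (simp add: flow_matrix_def)
    also have "\<dots> \<le> (\<Sum>j\<in>UNIV. flow_matrix V f g j)"
      by (rule member_le_sum) (auto intro: routing_nonneg[OF flow_matrix(1)[OF f]])
    also have "\<dots> \<le> ?A" using flow_matrix(2)[OF f] src m(2) by simp
    finally show ?thesis using AB by simp
  next
    case t
    have "f e \<le> \<gamma> $ j" using cap(2)[OF e] t by (simp add: set_sink_caps_simps)
    also have "\<dots> \<le> ?B" by (rule member_le_sum) (use t \<gamma> in auto)
    finally show ?thesis using AB by simp
  qed
qed

text \<open>All four facts are reachability arguments: an infinite arc is never saturated, positive
  flow opens the reverse arc, an unsaturated source arc reaches its group, and an unsaturated sink
  arc at a reachable variable would complete an augmenting path.\<close>

lemma min_cut_structure: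
  fixes V :: "('n::finite) node set"
  defines "c \<equiv> \<lambda>\<gamma> lam \<eta>. set_sink_caps (vars V) \<gamma> (canonical_cap lam \<eta>)"
  assumes mx: "is_max_flow Source Sink (V \<union> {Source, Sink}) (arcs_on V) (c \<gamma> lam \<eta>) f"
    and Vp: "Vp = V \<inter> (residual_arcs (arcs_on V) (c \<gamma> lam \<eta>) f)\<^sup>* `` {Source}"
    and Vm: "Vm = V - Vp"
  shows "\<lbrakk>g \<in> groups Vp; j \<in> g; j \<in> vars V\<rbrakk> \<Longrightarrow> j \<in> vars Vp"
    and "\<lbrakk>g \<in> groups Vm; j \<in> vars Vp\<rbrakk> \<Longrightarrow> flow_matrix V f g j = 0"
    and "g \<in> groups Vm \<Longrightarrow> f (Source, Group g) = lam * \<eta> g"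
    and "j \<in> vars Vp \<Longrightarrow> f (Var j, Sink) = \<gamma> $ j"
proof -
  let ?R = "residual_arcs (arcs_on V) (c \<gamma> lam \<eta>) f"
  have f: "0 \<le> f a" "ereal (f a) \<le> c \<gamma> lam \<eta> a" if "a \<in> arcs_on V" for a
    using mx that by (auto simp: is_max_flow_def is_flow_def)
  have sink: "(Source, Sink) \<notin> ?R\<^sup>*"
    by (rule max_flow_no_augmenting_path[OF finite_arcs_on _ mx]) simp
  show "j \<in> vars Vp" if "g \<in> groups Vp" "j \<in> g" "j \<in> vars V"
  proof -
    have "(Group g, Var j) \<in> ?R"
      using that by (auto simp: residual_arcs_def arcs_on_def c_def set_sink_caps_simps groups_def Vp)
    then show ?thesis
      using that by (auto simp: groups_def vars_def Vp intro: rtrancl_into_rtrancl)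
  qed
  show "flow_matrix V f g j = 0" if g: "g \<in> groups Vm" and j: "j \<in> vars Vp"
  proof (rule ccontr)
    assume nz: "flow_matrix V f g j \<noteq> 0"
    then have a: "(Group g, Var j) \<in> arcs_on V" "f (Group g, Var j) \<noteq> 0"
      by (auto simp: flow_matrix_def arcs_on_def split: if_splits)
    then have "(Var j, Group g) \<in> ?R"
      using f(1)[OF a(1)] by (auto simp: residual_arcs_def)
    then show False
      using g j by (auto simp: groups_def vars_def Vp Vm intro: rtrancl_into_rtrancl)
  qed
  show "f (Source, Group g) = lam * \<eta> g" if g: "g \<in> groups Vm"
  proof (rule ccontr)
    assume ne: "f (Source, Group g) \<noteq> lam * \<eta> g"
    have a: "(Source, Group g) \<in> arcs_on V" using g by (auto simp: arcs_on_def groups_def Vm)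
    then have "(Source, Group g) \<in> ?R"
      using f(2)[OF a] ne by (auto simp: residual_arcs_def c_def set_sink_caps_simps)
    then show False using g by (auto simp: groups_def Vp Vm)
  qed
  show "f (Var j, Sink) = \<gamma> $ j" if j: "j \<in> vars Vp"
  proof (rule ccontr)
    assume ne: "f (Var j, Sink) \<noteq> \<gamma> $ j"
    have jV: "j \<in> vars V" using j by (auto simp: vars_def Vp)
    then have a: "(Var j, Sink) \<in> arcs_on V" by (auto simp: arcs_on_def)
    then have "(Var j, Sink) \<in> ?R"
      using f(2)[OF a] ne jV by (auto simp: residual_arcs_def c_def set_sink_caps_simps)
    then show False using j sink by (auto simp: vars_def Vp intro: rtrancl_into_rtrancl)
  qed
qed

section \<open>Correctness of the recursion\<close>

text \<open>Termination and optimality share one induction because the recursion equation is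
  available only on the domain. The routing is existentially quantified since the algorithm returns
  only the sink loads.\<close>

lemma computeFlow_kkt:
  fixes V :: "('n::finite) node set"
  assumes mf: "max_flow_solver mf" and u: "\<And>j. 0 \<le> u $ j"
    and "Source \<notin> V" "Sink \<notin> V"
    and "\<And>g. g \<in> groups V \<Longrightarrow> 0 < lam * \<eta> g"
  shows "computeFlow_dom (mf, u, \<eta>, lam, V, arcs_on V) \<and>
    (\<exists>F. kkt u (\<lambda>g. lam * \<eta> g) (vars V) (groups V) (computeFlow mf u \<eta> lam V (arcs_on V)) F)"
  using finite_nodes[of V] assms(3-5)
proof (induction V rule: finite_psubset_induct)
  case (psubset V)
  note r = \<open>\<And>g. g \<in> groups V \<Longrightarrow> 0 < lam * \<eta> g\<close>
  note ss = \<open>Source \<notin> V\<close> \<open>Sink \<notin> V\<close>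
  define b where "b = lam * (\<Sum>g\<in>groups V. \<eta> g)"
  have b: "b = (\<Sum>g\<in>groups V. lam * \<eta> g)" by (simp add: b_def sum_distrib_left)
  define \<gamma> where "\<gamma> = projection u (vars V) b"
  define c where "c = set_sink_caps (vars V) \<gamma> (canonical_cap lam \<eta>)"
  define f where "f = mf Source Sink (V \<union> {Source, Sink}) (arcs_on V) c"
  define \<xi> where "\<xi> = (\<chi> j. if j \<in> vars V then f (Var j, Sink) else 0)"
  define Vp where "Vp = V \<inter> (residual_arcs (arcs_on V) c f)\<^sup>* `` {Source}"
  define Vm where "Vm = V - Vp"
  have b0: "0 \<le> b" unfolding b using r by (intro sum_nonneg) (simp add: less_imp_le)
  obtain \<tau> where \<tau>: "0 \<le> \<tau>" "(\<Sum>j\<in>vars V. max (u $ j - \<tau>) 0) \<le> b"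
    "\<tau> = 0 \<or> (\<Sum>j\<in>vars V. max (u $ j - \<tau>) 0) = b"
    using threshold_exists[OF b0] by blast
  have \<gamma>: "\<gamma> $ j = max (u $ j - \<tau>) 0" if "j \<in> vars V" for j
    unfolding \<gamma>_def projection_threshold[OF \<tau>] using that by simp
  have sum\<gamma>: "(\<Sum>j\<in>vars V. \<gamma> $ j) = (\<Sum>j\<in>vars V. max (u $ j - \<tau>) 0)"
    using \<gamma> by (intro sum.cong) auto
  have "\<exists>f. is_max_flow Source Sink (V \<union> {Source, Sink}) (arcs_on V) c f"
    unfolding c_def by (rule canonical_max_flow_exists) (use r \<gamma> in \<open>auto simp: less_imp_le\<close>)
  then have mx: "is_max_flow Source Sink (V \<union> {Source, Sink}) (arcs_on V) c f"
    using mf unfolding max_flow_solver_def f_def by blast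
  then have fl: "is_flow Source Sink (V \<union> {Source, Sink}) (arcs_on V) c f"
    by (simp add: is_max_flow_def)
  note F = flow_matrix[OF fl]
  have fcap: "f (Source, Group g) \<le> lam * \<eta> g" if "g \<in> groups V" for g
    using fl that by (force simp: is_flow_def arcs_on_def c_def set_sink_caps_simps)
  have f\<gamma>: "f (Var j, Sink) \<le> \<gamma> $ j" if "j \<in> vars V" for j
    using fl that by (force simp: is_flow_def arcs_on_def c_def set_sink_caps_simps)
  note cut = min_cut_structure[OF mx[unfolded c_def] Vp_def[unfolded c_def] Vm_def]
  have sub: "Vp \<subseteq> V" "Vm \<subseteq> V" by (auto simp: Vp_def Vm_def)
  have parts: "vars V = vars Vp \<union> vars Vm" "groups V = groups Vp \<union> groups Vm"
    "vars Vp \<inter> vars Vm = {}" "groups Vp \<inter> groups Vm = {}"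
    by (auto simp: vars_def groups_def Vp_def Vm_def)
  \<comment> \<open>A deficit at \<open>j\<close> makes the flow smaller than the budget, so some
    source arc is unsaturated and its group lies in \<open>Vp\<close>, while \<open>j\<close> lies
    in \<open>Vm\<close>.\<close>
  have split: "Vp \<subset> V \<and> Vm \<subset> V" if j: "j \<in> vars V" and ne: "f (Var j, Sink) \<noteq> \<gamma> $ j" for j
  proof -
    have "(\<Sum>g\<in>groups V. f (Source, Group g)) = (\<Sum>i\<in>vars V. f (Var i, Sink))"
      by (rule sum_source_eq_sum_sink[OF fl])
    also have "\<dots> < (\<Sum>i\<in>vars V. \<gamma> $ i)"
      by (rule sum_strict_mono_ex1) (use j ne f\<gamma> in \<open>force simp: less_le\<close>)+
    also have "\<dots> \<le> (\<Sum>g\<in>groups V. lam * \<eta> g)" using \<tau>(2) sum\<gamma> b by simp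
    finally obtain g where g: "g \<in> groups V" "f (Source, Group g) \<noteq> lam * \<eta> g"
      by (metis (no_types, lifting) less_irrefl sum.cong)
    then have "g \<notin> groups Vm" using cut(3) by blast
    then have "Group g \<in> V" "Group g \<notin> Vm" using g by (auto simp: groups_def)
    moreover have "j \<notin> vars Vp" using cut(4) ne by blast
    then have "Var j \<in> V" "Var j \<notin> Vp" using j by (auto simp: vars_def)
    ultimately show ?thesis using sub by blast
  qed
  have IH: "computeFlow_dom (mf, u, \<eta>, lam, W, restrict_arcs W (arcs_on V))"
    "\<exists>F. kkt u (\<lambda>g. lam * \<eta> g) (vars W) (groups W) (computeFlow mf u \<eta> lam W (restrict_arcs W (arcs_on V))) F"
    if "W \<subset> V" for W
  proof -
    have "0 < lam * \<eta> g" if "g \<in> groups W" for g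
      using that \<open>W \<subset> V\<close> by (intro r) (auto simp: groups_def)
    then have "computeFlow_dom (mf, u, \<eta>, lam, W, arcs_on W) \<and>
      (\<exists>F. kkt u (\<lambda>g. lam * \<eta> g) (vars W) (groups W) (computeFlow mf u \<eta> lam W (arcs_on W)) F)"
      using that ss by (intro psubset.IH) auto
    moreover have "restrict_arcs W (arcs_on V) = arcs_on W"
      using that ss by (intro restrict_arcs_on) auto
    ultimately show "computeFlow_dom (mf, u, \<eta>, lam, W, restrict_arcs W (arcs_on V))"
      "\<exists>F. kkt u (\<lambda>g. lam * \<eta> g) (vars W) (groups W) (computeFlow mf u \<eta> lam W (restrict_arcs W (arcs_on V))) F"
      by auto
  qed
  \<comment> \<open>The domain rule presents the vertex set through \<open>insert\<close>;
    afterwards the abbreviations are folded from the inside out.\<close>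
  have ins: "insert Source (insert Sink V) = V \<union> {Source, Sink}" by auto
  have dom: "computeFlow_dom (mf, u, \<eta>, lam, V, arcs_on V)"
  proof (rule computeFlow.domintros, unfold ins b_def[symmetric], unfold \<gamma>_def[symmetric],
      unfold c_def[symmetric], unfold f_def[symmetric], unfold Vp_def[symmetric], unfold Vm_def[symmetric])
    fix j assume j: "j \<in> vars V" "f (Var j, Sink) \<noteq> \<gamma> $ j"
    show "computeFlow_dom (mf, u, \<eta>, lam, Vp, restrict_arcs Vp (arcs_on V))"
      "computeFlow_dom (mf, u, \<eta>, lam, Vm, restrict_arcs Vm (arcs_on V))"
      using split[OF j] IH(1) by auto
  qed
  have step_eq: "computeFlow mf u \<eta> lam V (arcs_on V) =
    (if \<exists>j\<in>vars V. \<xi> $ j \<noteq> \<gamma> $ j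
     then \<chi> j. if j \<in> vars Vp then computeFlow mf u \<eta> lam Vp (restrict_arcs Vp (arcs_on V)) $ j
       else if j \<in> vars Vm then computeFlow mf u \<eta> lam Vm (restrict_arcs Vm (arcs_on V)) $ j else 0
     else \<xi>)"
    unfolding computeFlow.psimps[OF dom] Let_def b_def[symmetric]
    unfolding \<gamma>_def[symmetric] unfolding c_def[symmetric] unfolding f_def[symmetric]
    unfolding \<xi>_def[symmetric] unfolding Vp_def[symmetric] unfolding Vm_def[symmetric] ..
  have "\<exists>F. kkt u (\<lambda>g. lam * \<eta> g) (vars V) (groups V) (computeFlow mf u \<eta> lam V (arcs_on V)) F"
  proof (cases "\<exists>j\<in>vars V. \<xi> $ j \<noteq> \<gamma> $ j")
    case True
    then obtain j where "j \<in> vars V" "f (Var j, Sink) \<noteq> \<gamma> $ j" by (auto simp: \<xi>_def)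
    from split[OF this] have pm: "Vp \<subset> V" "Vm \<subset> V" by auto
    from IH(2)[OF pm(1)] IH(2)[OF pm(2)] obtain Fp Fm where
      K: "kkt u (\<lambda>g. lam * \<eta> g) (vars Vp) (groups Vp) (computeFlow mf u \<eta> lam Vp (restrict_arcs Vp (arcs_on V))) Fp"
      "kkt u (\<lambda>g. lam * \<eta> g) (vars Vm) (groups Vm) (computeFlow mf u \<eta> lam Vm (restrict_arcs Vm (arcs_on V))) Fm"
      by blast
    have "kkt u (\<lambda>g. lam * \<eta> g) (vars V) (groups V) (computeFlow mf u \<eta> lam V (arcs_on V)) (\<lambda>g j. Fp g j + Fm g j)"
      unfolding step_eq unfolding if_P[OF True] unfolding parts(1,2)
    proof (rule kkt_glue[OF K parts(3,4) \<tau>(1), where f = "flow_matrix V f"])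
      show "routing (groups Vp \<union> groups Vm) (vars Vp \<union> vars Vm) (flow_matrix V f)"
        using F(1) parts by simp
      show "0 < lam * \<eta> g" if "g \<in> groups Vm" for g using that r parts by auto
      show "j \<in> vars Vp" if "g \<in> groups Vp" "j \<in> g" "j \<in> vars Vp \<union> vars Vm" for g j
        using cut(1)[OF that(1,2)] that(3) parts by simp
      show "flow_matrix V f g j = 0" if "g \<in> groups Vm" "j \<in> vars Vp" for g j
        using cut(2)[OF that] .
      show "(\<Sum>j\<in>UNIV. flow_matrix V f g j) = lam * \<eta> g" if "g \<in> groups Vm" for g
        using F(2)[of g] cut(3)[OF that] that parts by simp
      show "(\<Sum>j\<in>UNIV. flow_matrix V f g j) \<le> lam * \<eta> g" if "g \<in> groups Vp" for g
        using F(2)[of g] fcap[of g] that parts by simp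
      show "(\<Sum>g\<in>UNIV. flow_matrix V f g j) = max (u $ j - \<tau>) 0" if "j \<in> vars Vp" for j
        using F(3)[of j] cut(4)[OF that] \<gamma>[of j] that parts by simp
      show "(\<Sum>g\<in>UNIV. flow_matrix V f g j) \<le> max (u $ j - \<tau>) 0" if "j \<in> vars Vm" for j
        using F(3)[of j] f\<gamma>[of j] \<gamma>[of j] that parts by simp
    qed
    then show ?thesis by blast
  next
    case False
    then have eq: "\<xi> $ j = \<gamma> $ j" if "j \<in> vars V" for j using that by blast
    have "kkt u (\<lambda>g. lam * \<eta> g) (vars V) (groups V) (computeFlow mf u \<eta> lam V (arcs_on V)) (flow_matrix V f)"
      unfolding step_eq unfolding if_not_P[OF False]
    proof (rule kkt_threshold[OF u \<tau>(1) F(1)])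
      show "(\<Sum>j\<in>UNIV. flow_matrix V f g j) \<le> lam * \<eta> g" if "g \<in> groups V" for g
        using F(2)[OF that] fcap[OF that] by simp
      show "\<xi> $ j = max (u $ j - \<tau>) 0" if "j \<in> vars V" for j
        using eq[OF that] \<gamma>[OF that] by simp
      show "\<xi> $ j = (\<Sum>g\<in>UNIV. flow_matrix V f g j)" if "j \<in> vars V" for j
        using F(3)[OF that] that by (simp add: \<xi>_def)
      show "\<tau> = 0 \<or> (\<Sum>j\<in>vars V. \<xi> $ j) = (\<Sum>g\<in>groups V. lam * \<eta> g)"
        using \<tau>(3) eq sum\<gamma> b by simp
    qed
    then show ?thesis by blast
  qed
  with dom show ?case by blast
qed

section \<open>From the optimality conditions to the proximal problem\<close>

text \<open>\<open>u - w\<close> is a subgradient of the penalty at \<open>w\<close>: its inner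
  product with \<open>z\<close> is at most the penalty of \<open>z\<close>, with equality at
  \<open>z = w\<close>. Expanding the square adds the strong convexity term.\<close>

lemma kkt_prox_gap:
  fixes u :: "real ^ ('n::finite)"
  assumes K: "kkt (abs_vec u) (\<lambda>g. lam * \<eta> g) UNIV \<G> \<xi> F"
    and ne: "{} \<notin> \<G>"
    and w: "w = (\<chi> j. sgn (u $ j) * (\<bar>u $ j\<bar> - \<xi> $ j))"
  shows "prox_objective u \<G> \<eta> lam w + 1 / 2 * (norm (z - w))\<^sup>2 \<le> prox_objective u \<G> \<eta> lam z"
proof -
  note R = kktD(1)[OF K]
  have \<xi>: "\<xi> $ j = (\<Sum>g\<in>\<G>. F g j)" for j
  proof -
    have "(\<Sum>g\<in>UNIV. F g j) = (\<Sum>g\<in>\<G>. F g j)"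
      using routing_support[OF R] by (intro sum.mono_neutral_right) auto
    then show ?thesis using kktD(3)[OF K, of j] by simp
  qed
  have \<xi>0: "0 \<le> \<xi> $ j" for j unfolding \<xi> by (intro sum_nonneg routing_nonneg[OF R])
  have le: "\<xi> $ j \<le> \<bar>u $ j\<bar>" for j using kktD(4)[OF K, of j] by (simp add: abs_vec_def)
  \<comment> \<open>Since \<open>0 \<le> \<xi> $ j \<le> \<bar>u $ j\<bar>\<close>, shrinking never
    flips a sign; at \<open>u $ j = 0\<close> both sides vanish.\<close>
  have absw: "\<bar>w $ j\<bar> = \<bar>u $ j\<bar> - \<xi> $ j" for j
    using \<xi>0[of j] le[of j] by (auto simp: w abs_mult abs_sgn_eq)
  have uw: "u $ j - w $ j = sgn (u $ j) * \<xi> $ j" for j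
    by (simp add: w algebra_simps abs_mult_sgn mult.commute[of "sgn _" "\<bar>_\<bar>"])
  have pair: "(\<Sum>j\<in>UNIV. \<xi> $ j * x j) = (\<Sum>g\<in>\<G>. \<Sum>j\<in>UNIV. F g j * x j)" for x :: "'n \<Rightarrow> real"
    unfolding \<xi> sum_distrib_right by (rule sum.swap)
  have upper: "(\<Sum>j\<in>UNIV. \<xi> $ j * \<bar>z $ j\<bar>) \<le> lam * group_norm \<G> \<eta> z"
  proof -
    have "(\<Sum>j\<in>UNIV. F g j * \<bar>z $ j\<bar>) \<le> lam * \<eta> g * Max ((\<lambda>j. \<bar>z $ j\<bar>) ` g)" if g: "g \<in> \<G>" for g
    proof -
      let ?M = "Max ((\<lambda>j. \<bar>z $ j\<bar>) ` g)"
      \<comment> \<open>A member of \<open>g\<close> is needed to see that the maximum is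
        nonnegative, so that the mass of \<open>F g\<close> may be replaced by its bound.\<close>
      obtain k where "k \<in> g" using g ne by (metis all_not_in_conv)
      then have "\<bar>z $ k\<bar> \<le> ?M" by (intro Max_ge) auto
      then have M0: "0 \<le> ?M" by (rule order_trans[OF abs_ge_zero])
      have "(\<Sum>j\<in>UNIV. F g j * \<bar>z $ j\<bar>) \<le> (\<Sum>j\<in>UNIV. F g j * ?M)"
      proof (rule sum_mono)
        fix j
        show "F g j * \<bar>z $ j\<bar> \<le> F g j * ?M"
          using routing_support[OF R, of g j] routing_nonneg[OF R, of g j]
          by (cases "F g j = 0") (auto intro!: mult_left_mono Max_ge)
      qed
      also have "\<dots> \<le> lam * \<eta> g * ?M"
        unfolding sum_distrib_right[symmetric] using kktD(2)[OF K g] M0 by (rule mult_right_mono)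
      finally show ?thesis .
    qed
    then show ?thesis
      unfolding pair group_norm_def sum_distrib_left mult.assoc[symmetric] by (rule sum_mono)
  qed
  have lower: "(\<Sum>j\<in>UNIV. \<xi> $ j * \<bar>w $ j\<bar>) = lam * group_norm \<G> \<eta> w"
  proof -
    have "(\<Sum>j\<in>UNIV. F g j * \<bar>w $ j\<bar>) = lam * \<eta> g * Max ((\<lambda>j. \<bar>w $ j\<bar>) ` g)" if g: "g \<in> \<G>" for g
    proof -
      let ?M = "Max ((\<lambda>j. \<bar>w $ j\<bar>) ` g)"
      have gne: "g \<noteq> {}" using g ne by auto
      have "F g j * \<bar>w $ j\<bar> = F g j * ?M" for j
      proof (cases "F g j = 0")
        case False
        then have "0 < F g j" "j \<in> g"
          using routing_support[OF R, of g j] routing_nonneg[OF R, of g j] by auto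
        then have "?M = \<bar>w $ j\<bar>"
          using kktD(5)[OF K, of g j] by (intro Max_eqI) (auto simp: absw abs_vec_def)
        then show ?thesis by simp
      qed simp
      then have eq: "(\<Sum>j\<in>UNIV. F g j * \<bar>w $ j\<bar>) = (\<Sum>j\<in>UNIV. F g j) * ?M"
        unfolding sum_distrib_right by (rule sum.cong[OF refl])
      show ?thesis
      proof (cases "(\<Sum>j\<in>UNIV. F g j) = lam * \<eta> g")
        case False
        then have "(\<Sum>j\<in>UNIV. F g j) < lam * \<eta> g" using kktD(2)[OF K g] by simp
        then have "\<bar>w $ i\<bar> = 0" if "i \<in> g" for i
          using kktD(6)[OF K g _ that] by (simp add: absw abs_vec_def)
        then have "(\<lambda>j. \<bar>w $ j\<bar>) ` g = {0}" using gne by force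
        then show ?thesis using eq by simp
      qed (simp add: eq)
    qed
    then show ?thesis
      unfolding pair group_norm_def sum_distrib_left mult.assoc[symmetric] by (intro sum.cong) auto
  qed
  have "(u - w) \<bullet> w = (\<Sum>j\<in>UNIV. \<xi> $ j * \<bar>w $ j\<bar>)"
  proof -
    have "(sgn (u $ j) * \<xi> $ j) * w $ j = \<xi> $ j * \<bar>w $ j\<bar>" for j
    proof (cases "u $ j = 0")
      case True
      then show ?thesis using \<xi>0[of j] le[of j] by simp
    next
      case False
      then have "sgn (u $ j) * sgn (u $ j) = 1" by (simp add: sgn_if)
      moreover have "(sgn (u $ j) * \<xi> $ j) * w $ j = (sgn (u $ j) * sgn (u $ j)) * (\<xi> $ j * \<bar>w $ j\<bar>)"
        unfolding absw by (simp add: w)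
      ultimately show ?thesis by simp
    qed
    then show ?thesis
      unfolding inner_vec_def inner_real_def vector_minus_component uw by (intro sum.cong refl)
  qed
  moreover have "(u - w) \<bullet> z \<le> (\<Sum>j\<in>UNIV. \<xi> $ j * \<bar>z $ j\<bar>)"
  proof -
    have "(sgn (u $ j) * \<xi> $ j) * z $ j \<le> \<xi> $ j * \<bar>z $ j\<bar>" for j
    proof -
      have "sgn (u $ j) * z $ j \<le> \<bar>z $ j\<bar>" by (auto simp: sgn_if)
      from mult_left_mono[OF this \<xi>0[of j]] show ?thesis by (simp add: algebra_simps)
    qed
    then show ?thesis
      unfolding inner_vec_def inner_real_def vector_minus_component uw by (intro sum_mono)
  qed
  ultimately have "(u - w) \<bullet> (z - w) \<le> lam * group_norm \<G> \<eta> z - lam * group_norm \<G> \<eta> w"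
    using upper lower by (simp add: inner_diff_right)
  moreover have "(norm (u - z))\<^sup>2 = (norm (u - w))\<^sup>2 - 2 * ((u - w) \<bullet> (z - w)) + (norm (z - w))\<^sup>2"
    by (simp add: power2_norm_eq_inner inner_diff_left inner_diff_right inner_commute)
  ultimately show ?thesis by (simp add: prox_objective_def field_simps)
qed

theorem proposition7:
  fixes \<G> :: "('n::finite) set set" and \<eta> :: "'n set \<Rightarrow> real" and lam :: real
    and u :: "real ^ 'n" and mf :: "'n node flow_solver"
  assumes "{} \<notin> \<G>"
    and "\<And>g. g \<in> \<G> \<Longrightarrow> 0 < \<eta> g"
    and "0 < lam"
    and "max_flow_solver mf"
  shows "algorithm1_terminates mf u \<G> \<eta> lam \<and>
    is_arg_min (prox_objective u \<G> \<eta> lam) (\<lambda>_. True) (algorithm1 mf u \<G> \<eta> lam) \<and>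
    (\<forall>w. is_arg_min (prox_objective u \<G> \<eta> lam) (\<lambda>_. True) w \<longrightarrow> w = algorithm1 mf u \<G> \<eta> lam)"
proof -
  let ?V = "canonical_verts \<G>"
  have V: "vars ?V = UNIV" "groups ?V = \<G>" "Source \<notin> ?V" "Sink \<notin> ?V"
    by (auto simp: vars_def groups_def canonical_verts_def)
  define \<xi> where "\<xi> = computeFlow mf (abs_vec u) \<eta> lam ?V (canonical_arcs \<G>)"
  have "computeFlow_dom (mf, abs_vec u, \<eta>, lam, ?V, canonical_arcs \<G>) \<and>
    (\<exists>F. kkt (abs_vec u) (\<lambda>g. lam * \<eta> g) (vars ?V) (groups ?V) \<xi> F)"
    unfolding \<xi>_def canonical_arcs_eq
    by (rule computeFlow_kkt) (use assms V in \<open>auto simp: abs_vec_def\<close>)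
  then obtain F where dom: "algorithm1_terminates mf u \<G> \<eta> lam"
    and K: "kkt (abs_vec u) (\<lambda>g. lam * \<eta> g) UNIV \<G> \<xi> F"
    unfolding V algorithm1_terminates_def by blast
  define w where "w = algorithm1 mf u \<G> \<eta> lam"
  have "w = (\<chi> j. sgn (u $ j) * (\<bar>u $ j\<bar> - \<xi> $ j))"
    by (simp add: w_def algorithm1_def algorithm1_nonneg_def abs_vec_def \<xi>_def)
  \<comment> \<open>The quadratic surplus yields both minimality and uniqueness.\<close>
  note gap = kkt_prox_gap[OF K assms(1) this]
  have "prox_objective u \<G> \<eta> lam w \<le> prox_objective u \<G> \<eta> lam z" for z
    using gap[of z] zero_le_power2[of "norm (z - w)"] by linarith
  then have min: "is_arg_min (prox_objective u \<G> \<eta> lam) (\<lambda>_. True) w"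
    by (simp add: is_arg_min_def not_less)
  have "z = w" if "is_arg_min (prox_objective u \<G> \<eta> lam) (\<lambda>_. True) z" for z
  proof -
    have "prox_objective u \<G> \<eta> lam z \<le> prox_objective u \<G> \<eta> lam w"
      using that by (simp add: is_arg_min_def not_less)
    then have "(norm (z - w))\<^sup>2 \<le> 0" using gap[of z] by linarith
    then show ?thesis by simp
  qed
  with dom min show ?thesis unfolding w_def by blast
qed

end
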